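(* Consider the system $\dot x=f(t,x)$, $t\ge t_0$, on $\mathbb{R}^n$, with $f(t,x)$ piecewise continuous in $t$, continuously differentiable in $x$, and forward complete, and let $K\subset\mathbb{R}^n$ be a compact set with nonempty interior. Let $x_i$ and $f_i(t,x)$ denote the $i$-th scalar components of $x$ and $f(t,x)$. Suppose there is a Metzler matrix $\hat A=[\hat a_{ij}]\in\mathbb{R}^{n\times n}$ such that, for all $i,j\in\{1,\dots,n\}$ with $i\ne j$, $$\hat a_{ii}\ge\limsup_{t\to\infty}\max_{v\in\operatorname{co}(\xi(t,t_0,K))}\partial_{x_i}f_i(t,v),\qquad \hat a_{ij}\ge\limsup_{t\to\infty}\max_{v\in\operatorname{co}(\xi(t,t_0,K))}|\partial_{x_j}f_i(t,v)|.$$ Then the topological entropy of the system satisfies $$h(f,t_0,K)\le n\max\{\lambda_{\max}(\hat A),\,0\}.$$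
   Context: $\xi(t,t_0,x)$ denotes the solution at time $t$ with state $x$ at time $t_0$, and $\xi(t,t_0,K):=\{\xi(t,t_0,x):x\in K\}$. $\partial_{x_j}f_i(t,v)$ is the partial derivative of $f_i(t,x)$ with respect to $x_j$ at $x=v$. $\operatorname{co}$ denotes convex hull. A Metzler matrix is a real square matrix with nonnegative off-diagonal entries; $\lambda_{\max}(M)$ denotes its eigenvalue with the largest real part (which is real). Topological entropy: fix a norm $|\cdot|$ on $\mathbb{R}^n$ (the entropy does not depend on this choice). For $T\ge0$, $\varepsilon>0$, let $B_{f,t_0}(x,\varepsilon,T):=\{\bar x\in\mathbb{R}^n:\max_{t\in[t_0,t_0+T]}|\xi(t,t_0,\bar x)-\xi(t,t_0,x)|<\varepsilon\}$. A subset $E\subset K$ is $(T,\varepsilon)$-spanning if $K\subset\bigcup_{x\in E}B_{f,t_0}(x,\varepsilon,T)$; $S(f,t_0,\varepsilon,T,K)$ is the minimal cardinality of a $(T,\varepsilon)$-spanning set. Then $h(f,t_0,K):=\lim_{\varepsilon\searrow0}\limsup_{T\to\infty}\frac1T\log S(f,t_0,\varepsilon,T,K)$ (natural logarithm).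
   Formalization: The regularity of f is strengthened: besides being piecewise continuous in t and continuously differentiable in x, f is assumed locally Lipschitz in x, locally uniformly in t; without this the flow can be discontinuous and the bound false. *)

theory Defs
  imports "HOL-Analysis.Analysis"
begin

definition piecewise_continuous_from :: "real \<Rightarrow> (real \<Rightarrow> 'a::topological_space) \<Rightarrow> bool" where
  "piecewise_continuous_from t0 g \<longleftrightarrow>
     (\<exists>D. (\<forall>T. finite (D \<inter> {t0..T})) \<and>
          (\<forall>t\<ge>t0. t \<notin> D \<longrightarrow> continuous (at t within {t0..}) g) \<and>
          (\<forall>t\<ge>t0. \<exists>l. (g \<longlongrightarrow> l) (at_right t)) \<and>
          (\<forall>t>t0. \<exists>l. (g \<longlongrightarrow> l) (at_left t)))"

definition C1_map :: "(real^'n \<Rightarrow> real^'n) \<Rightarrow> bool" where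
  "C1_map g \<longleftrightarrow> (\<forall>x. g differentiable (at x)) \<and> continuous_on UNIV (\<lambda>x. jacobian g (at x))"

text \<open>
  The last conjunct makes the regularity in \<open>x\<close> locally uniform in \<open>t\<close>, the usual
  well-posedness condition for right-hand sides that are piecewise continuous in \<open>t\<close>.  It
  holds, for example, if \<open>f\<close> and its Jacobian in \<open>x\<close> are jointly continuous between isolated
  switching times and extend continuously to the closures of these pieces.  Without it
  solutions need not depend continuously on the initial state.
\<close>

definition regular_rhs :: "real \<Rightarrow> (real \<Rightarrow> real^'n \<Rightarrow> real^'n) \<Rightarrow> bool" where
  "regular_rhs t0 f \<longleftrightarrow>
     (\<forall>x. piecewise_continuous_from t0 (\<lambda>t. f t x)) \<and>
     (\<forall>t\<ge>t0. C1_map (f t)) \<and>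
     local_lipschitz {t0..} UNIV f"

definition partial_deriv :: "(real^'n \<Rightarrow> real^'n) \<Rightarrow> 'n \<Rightarrow> 'n \<Rightarrow> real^'n \<Rightarrow> real" where
  "partial_deriv g i j v = deriv (\<lambda>s. g (v + s *\<^sub>R axis j 1) $ i) 0"

text \<open>
  The differential equation may fail at the times where \<open>\<lambda>t. f t (\<phi> t)\<close> jumps.  Since the
  discontinuity times of \<open>\<lambda>t. f t x\<close> may depend on \<open>x\<close>, the exceptional set is only required
  to be countable; together with continuity of \<open>\<phi>\<close> this amounts to the integral equation
  \<open>\<phi> t = x + \<integral> f s (\<phi> s) ds\<close> over \<open>[t0, t]\<close>.
\<close>

definition solution_from :: "(real \<Rightarrow> real^'n \<Rightarrow> real^'n) \<Rightarrow> real \<Rightarrow> real^'n \<Rightarrow> (real \<Rightarrow> real^'n) \<Rightarrow> bool" where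
  "solution_from f t0 x \<phi> \<longleftrightarrow>
     \<phi> t0 = x \<and> continuous_on {t0..} \<phi> \<and>
     (\<exists>D. countable D \<and>
        (\<forall>t\<in>{t0..} - D. (\<phi> has_vector_derivative f t (\<phi> t)) (at t within {t0..})))"

definition forward_complete :: "(real \<Rightarrow> real^'n \<Rightarrow> real^'n) \<Rightarrow> real \<Rightarrow> bool" where
  "forward_complete f t0 \<longleftrightarrow> (\<forall>x. \<exists>\<phi>. solution_from f t0 x \<phi>)"

text \<open>Two solutions from the same state may differ before \<open>t0\<close>, so only the value is unique.\<close>

definition xi :: "(real \<Rightarrow> real^'n \<Rightarrow> real^'n) \<Rightarrow> real \<Rightarrow> real \<Rightarrow> real^'n \<Rightarrow> real^'n" where
  "xi f t t0 x = (THE y. \<exists>\<phi>. solution_from f t0 x \<phi> \<and> \<phi> t = y)"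

definition metzler :: "real^'n^'n \<Rightarrow> bool" where
  "metzler M \<longleftrightarrow> (\<forall>i j. i \<noteq> j \<longrightarrow> M $ i $ j \<ge> 0)"

definition complex_eigenvalue :: "real^'n^'n \<Rightarrow> complex \<Rightarrow> bool" where
  "complex_eigenvalue M \<mu> \<longleftrightarrow> (\<exists>v. v \<noteq> 0 \<and> map_matrix complex_of_real M *v v = \<mu> *s v)"

text \<open>
  The description denotes whenever some eigenvalue of largest real part is real, as is the case
  for every Metzler matrix.
\<close>

definition lambda_max :: "real^'n^'n \<Rightarrow> real" where
  "lambda_max M = (THE r. complex_eigenvalue M (complex_of_real r) \<and>
                          (\<forall>\<mu>. complex_eigenvalue M \<mu> \<longrightarrow> Re \<mu> \<le> r))"

definition is_norm :: "(real^'n \<Rightarrow> real) \<Rightarrow> bool" where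
  "is_norm N \<longleftrightarrow> (\<forall>x. N x = 0 \<longleftrightarrow> x = 0) \<and> (\<forall>c x. N (c *\<^sub>R x) = \<bar>c\<bar> * N x) \<and>
                 (\<forall>x y. N (x + y) \<le> N x + N y)"

definition dyn_ball ::
  "(real^'n \<Rightarrow> real) \<Rightarrow> (real \<Rightarrow> real^'n \<Rightarrow> real^'n) \<Rightarrow> real \<Rightarrow> real^'n \<Rightarrow> real \<Rightarrow> real \<Rightarrow> (real^'n) set" where
  "dyn_ball N f t0 x \<epsilon> T = {y. (SUP t\<in>{t0..t0+T}. N (xi f t t0 y - xi f t t0 x)) < \<epsilon>}"

definition is_spanning ::
  "(real^'n \<Rightarrow> real) \<Rightarrow> (real \<Rightarrow> real^'n \<Rightarrow> real^'n) \<Rightarrow> real \<Rightarrow> real \<Rightarrow> real \<Rightarrow> (real^'n) set \<Rightarrow> (real^'n) set \<Rightarrow> bool" where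
  "is_spanning N f t0 \<epsilon> T K E \<longleftrightarrow> E \<subseteq> K \<and> K \<subseteq> (\<Union>x\<in>E. dyn_ball N f t0 x \<epsilon> T)"

text \<open>Infinite if there is no finite spanning set.\<close>

definition min_spanning ::
  "(real^'n \<Rightarrow> real) \<Rightarrow> (real \<Rightarrow> real^'n \<Rightarrow> real^'n) \<Rightarrow> real \<Rightarrow> real \<Rightarrow> real \<Rightarrow> (real^'n) set \<Rightarrow> enat" where
  "min_spanning N f t0 \<epsilon> T K = (INF E\<in>{E. finite E \<and> is_spanning N f t0 \<epsilon> T K E}. enat (card E))"

fun ln_enat :: "enat \<Rightarrow> ereal" where
  "ln_enat (enat m) = (if m = 0 then -\<infinity> else ereal (ln (real m)))"
| "ln_enat \<infinity> = \<infinity>"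

definition top_entropy ::
  "(real^'n \<Rightarrow> real) \<Rightarrow> (real \<Rightarrow> real^'n \<Rightarrow> real^'n) \<Rightarrow> real \<Rightarrow> (real^'n) set \<Rightarrow> ereal" where
  "top_entropy N f t0 K =
     Lim (at_right 0) (\<lambda>\<epsilon>. Limsup at_top (\<lambda>T. ereal (1 / T) * ln_enat (min_spanning N f t0 \<epsilon> T K)))"

end

theory Submission
  imports Defs
begin

text \<open>
  For every \<open>\<rho> > lambda_max A\<close> a Metzler matrix \<open>A\<close> has a positive vector \<open>p\<close> and a \<open>d > 0\<close> with
  \<open>\<Sum>j. (A i j + d) * p j \<le> \<rho> * p i\<close> for all \<open>i\<close>: take Perron eigenvectors of \<open>A + d\<close> (all entries
  increased by \<open>d\<close>), found by Brouwer's theorem, and let \<open>d\<close> tend to 0.  By the mean value theorem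
  in each component and the bounds on the Jacobian, the weighted maximum norm
  \<open>max\<^sub>i \<bar>w i\<bar> / p i\<close> of the difference \<open>w\<close> of two solutions from \<open>K\<close> eventually has upper right
  derivative at most \<open>\<rho>\<close> times itself; before that time the flow is Lipschitz on \<open>K\<close>.
  Hence \<open>\<bar>w t\<bar> \<le> C * exp (\<rho> * (t - t0)) * \<bar>w t0\<bar>\<close> if \<open>\<rho> \<ge> 0\<close>, and a grid of mesh proportional to
  \<open>\<epsilon> * exp (- \<rho> * T)\<close> in \<open>K\<close> is spanning with \<open>O (exp (n * \<rho> * T))\<close> points.
\<close>

section \<open>Positive subeigenvectors of Metzler matrices\<close>

text \<open>Brouwer's theorem applies to \<open>B *v x\<close> rescaled to coordinate sum 1, a
  continuous self-map of the standard simplex \<open>S\<close>. A fixed point is an eigenvector with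
  eigenvalue \<open>s x\<close>, and it has positive entries because \<open>B\<close> sends every
  point of \<open>S\<close> to a positive vector.\<close>

lemma positive_matrix_positive_eigenvector:
  fixes B :: "real^'n^'n"
  assumes pos: "\<And>i j. B $ i $ j > 0"
  obtains x r where "\<And>i. x $ i > 0" "(\<Sum>i\<in>UNIV. x $ i) = 1" "B *v x = r *\<^sub>R x"
proof -
  define S where "S = {x::real^'n. (\<forall>i. 0 \<le> x $ i) \<and> (\<Sum>i\<in>UNIV. x $ i) = 1}"
  define s where "s x = (\<Sum>i\<in>UNIV. (B *v x) $ i)" for x
  have B_pos: "(B *v x) $ i > 0" if "x \<in> S" for x i
  proof -
    have nn: "\<And>j. 0 \<le> x $ j" and "(\<Sum>j\<in>UNIV. x $ j) = 1" using that by (auto simp: S_def)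
    then obtain j where "x $ j \<noteq> 0" by (metis sum.neutral zero_neq_one)
    then have "x $ j > 0" using nn[of j] by simp
    then have "(\<Sum>j\<in>UNIV. B $ i $ j * x $ j) > 0"
      using pos nn by (intro sum_pos2[of _ j]) (auto intro: mult_nonneg_nonneg less_imp_le)
    then show ?thesis by (simp add: matrix_vector_mult_def)
  qed
  have s_pos: "s x > 0" if "x \<in> S" for x
    unfolding s_def using B_pos[OF that] by (intro sum_pos) auto
  have "compact S"
  proof -
    have "norm x \<le> 1" if "x \<in> S" for x
      using norm_le_l1_cart[of x] that by (auto simp: S_def)
    then have "bounded S" by (auto simp: bounded_iff)
    moreover have "closed S" unfolding S_def
      by (intro closed_Collect_conj closed_Collect_all closed_Collect_le closed_Collect_eq continuous_intros)
    ultimately show ?thesis by (simp add: compact_eq_bounded_closed)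
  qed
  moreover have "convex S"
    unfolding convex_def S_def by (auto simp: sum.distrib simp flip: sum_distrib_left)
  moreover have "axis undefined 1 \<in> S" by (auto simp: S_def axis_def)
  then have "S \<noteq> {}" by blast
  moreover have "continuous_on S (\<lambda>x. (1 / s x) *\<^sub>R (B *v x))"
    using s_pos unfolding s_def
    by (intro continuous_intros matrix_vector_mult_linear_continuous_on ballI) fastforce
  moreover have "(\<lambda>x. (1 / s x) *\<^sub>R (B *v x)) \<in> S \<rightarrow> S"
  proof
    fix x assume x: "x \<in> S"
    have "(\<Sum>i\<in>UNIV. ((1 / s x) *\<^sub>R (B *v x)) $ i) = 1"
      using s_pos[OF x] by (simp add: s_def[of x] flip: sum_divide_distrib)
    then show "(1 / s x) *\<^sub>R (B *v x) \<in> S"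
      using B_pos[OF x] s_pos[OF x] unfolding S_def by (auto intro: less_imp_le)
  qed
  ultimately obtain x where x: "x \<in> S" "(1 / s x) *\<^sub>R (B *v x) = x" by (rule brouwer)
  have eq: "B *v x = s x *\<^sub>R x"
    using s_pos[OF x(1)] by (subst (3) x(2)[symmetric]) simp
  show ?thesis
  proof (rule that)
    show "x $ i > 0" for i
      by (subst x(2)[symmetric]) (use B_pos[OF x(1), of i] s_pos[OF x(1)] in simp)
  qed (use x(1) eq in \<open>auto simp: S_def\<close>)
qed

text \<open>Increasing all entries by \<open>d\<close> makes the off-diagonal ones positive; a
  further multiple \<open>c\<close> of the identity makes the diagonal positive as well. That shift
  leaves eigenvectors alone and is subtracted from the eigenvalue at the end.\<close>

lemma metzler_perturbed_positive_eigenvector: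
  fixes A :: "real^'n^'n"
  assumes "metzler A" "d > 0"
  obtains x r where "\<And>i. x $ i > 0" "(\<Sum>i\<in>UNIV. x $ i) = 1"
    "\<And>i. (\<Sum>j\<in>UNIV. (A $ i $ j + d) * x $ j) = r * x $ i"
proof -
  define c where "c = (\<Sum>i\<in>UNIV. \<bar>A $ i $ i\<bar>)"
  have c: "\<bar>A $ i $ i\<bar> \<le> c" for i unfolding c_def by (rule member_le_sum) auto
  define B :: "real^'n^'n" where "B = (\<chi> i j. A $ i $ j + d + (if i = j then c else 0))"
  have "B $ i $ j > 0" for i j
    using c[of i] assms unfolding B_def metzler_def by (cases "i = j") (auto intro: add_nonneg_pos)
  then obtain x r where x: "\<And>i. x $ i > 0" "(\<Sum>i\<in>UNIV. x $ i) = 1" "B *v x = r *\<^sub>R x"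
    using positive_matrix_positive_eigenvector by blast
  have "(\<Sum>j\<in>UNIV. (A $ i $ j + d) * x $ j) = (r - c) * x $ i" for i
  proof -
    have "(B *v x) $ i = (\<Sum>j\<in>UNIV. (A $ i $ j + d) * x $ j + (if i = j then c * x $ j else 0))"
      unfolding matrix_vector_mult_def B_def by (auto simp: algebra_simps intro!: sum.cong)
    also have "\<dots> = (\<Sum>j\<in>UNIV. (A $ i $ j + d) * x $ j) + c * x $ i"
      by (simp add: sum.distrib)
    finally show ?thesis using x(3) by (simp add: algebra_simps)
  qed
  with x(1,2) show ?thesis by (rule that)
qed

text \<open>A Gershgorin estimate in the weights \<open>p\<close>: in the row \<open>i\<close> where
  \<open>cmod (v $ i) / p i\<close> is largest, the off-diagonal part of the eigenvalue equation is
  controlled by the subeigenvector inequality.\<close>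

lemma metzler_eigenvalue_le:
  fixes A :: "real^'n^'n"
  assumes A: "metzler A" and p: "\<And>i. p i > 0"
    and sub: "\<And>i. (\<Sum>j\<in>UNIV. A $ i $ j * p j) \<le> r * p i"
    and ev: "complex_eigenvalue A \<mu>"
  shows "Re \<mu> \<le> r"
proof -
  obtain v where v: "v \<noteq> 0" "map_matrix complex_of_real A *v v = \<mu> *s v"
    using ev by (auto simp: complex_eigenvalue_def)
  define q where "q i = cmod (v $ i) / p i" for i
  obtain i where i: "\<And>j. q j \<le> q i"
  proof -
    have "Max (range q) \<in> range q" by (rule Max_in) auto
    then obtain i where "q i = Max (range q)" by (metis imageE)
    then show ?thesis using that[of i] by (simp add: Max_ge)
  qed
  obtain k where k: "v $ k \<noteq> 0" using v(1) by (auto simp: vec_eq_iff)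
  then have "q k > 0" using p[of k] by (simp add: q_def)
  then have q_pos: "q i > 0" using i[of k] by simp
  have le: "cmod (v $ j) \<le> q i * p j" for j
    using i[of j] p[of j] by (simp add: q_def field_simps)
  have vi: "cmod (v $ i) = q i * p i" using p[of i] by (simp add: q_def)
  have "(\<Sum>j\<in>UNIV. complex_of_real (A $ i $ j) * v $ j) = \<mu> * v $ i"
    using v(2) by (auto simp: vec_eq_iff matrix_vector_mult_def)
  \<comment> \<open>The diagonal entry may be negative, so it is moved to the left before taking
    absolute values; the remaining entries are nonnegative.\<close>
  then have "(\<mu> - A $ i $ i) * v $ i = (\<Sum>j\<in>UNIV - {i}. complex_of_real (A $ i $ j) * v $ j)"
    by (subst (asm) sum.remove[of _ i]) (auto simp: algebra_simps)
  then have "cmod (\<mu> - A $ i $ i) * cmod (v $ i) = cmod (\<Sum>j\<in>UNIV - {i}. complex_of_real (A $ i $ j) * v $ j)"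
    by (metis norm_mult)
  also have "\<dots> \<le> (\<Sum>j\<in>UNIV - {i}. A $ i $ j * (q i * p j))"
    using A le unfolding metzler_def
    by (intro sum_norm_le) (auto simp: norm_mult intro!: mult_left_mono)
  also have "\<dots> = q i * (\<Sum>j\<in>UNIV - {i}. A $ i $ j * p j)"
    by (simp add: sum_distrib_left algebra_simps)
  also have "\<dots> \<le> q i * ((r - A $ i $ i) * p i)"
    using sub[of i] q_pos sum.remove[of UNIV i "\<lambda>j. A $ i $ j * p j"]
    by (intro mult_left_mono) (auto simp: left_diff_distrib)
  finally have "cmod (\<mu> - A $ i $ i) * (q i * p i) \<le> (r - A $ i $ i) * (q i * p i)"
    by (simp add: vi algebra_simps)
  then have "cmod (\<mu> - A $ i $ i) \<le> r - A $ i $ i"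
    using q_pos p[of i] by (simp add: mult_le_cancel_right)
  moreover have "Re (\<mu> - A $ i $ i) \<le> cmod (\<mu> - A $ i $ i)" by (rule complex_Re_le_cmod)
  ultimately show ?thesis by simp
qed

text \<open>The eigenpairs of the perturbed matrices are bounded, so a subsequence converges to an
  eigenpair \<open>(y, L)\<close> of \<open>A\<close>. Each perturbed eigenvalue bounds the real
  parts of the spectrum of \<open>A\<close>, hence so does \<open>L\<close>. This identifies
  \<open>L\<close> as \<open>lambda_max A\<close>, including that the description denotes.\<close>

lemma metzler_subeigenvector:
  fixes A :: "real^'n^'n"
  assumes A: "metzler A" and \<rho>: "\<rho> > lambda_max A"
  obtains d p where "d > 0" "\<And>i. p i > 0" "\<And>i. (\<Sum>j\<in>UNIV. (A $ i $ j + d) * p j) \<le> \<rho> * p i"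
proof -
  define d where "d n = 1 / real (Suc n)" for n
  have d_pos: "d n > 0" and d_le: "d n \<le> 1" for n by (auto simp: d_def)
  have d_lim: "d \<longlonglongrightarrow> 0" unfolding d_def by (rule LIMSEQ_Suc[OF lim_1_over_n])
  have "\<exists>y. (\<forall>i. fst y $ i > 0) \<and> (\<Sum>i\<in>UNIV. fst y $ i) = 1 \<and>
      (\<forall>i. (\<Sum>j\<in>UNIV. (A $ i $ j + d n) * fst y $ j) = snd y * fst y $ i)" for n
  proof -
    obtain x r where "\<And>i. x $ i > 0" "(\<Sum>i\<in>UNIV. x $ i) = 1"
      "\<And>i. (\<Sum>j\<in>UNIV. (A $ i $ j + d n) * x $ j) = r * x $ i"
      using metzler_perturbed_positive_eigenvector[OF A d_pos] by blast
    then show ?thesis by (intro exI[of _ "(x, r)"]) auto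
  qed
  then obtain y where y: "\<And>n. (\<forall>i. fst (y n) $ i > 0) \<and> (\<Sum>i\<in>UNIV. fst (y n) $ i) = 1 \<and>
      (\<forall>i. (\<Sum>j\<in>UNIV. (A $ i $ j + d n) * fst (y n) $ j) = snd (y n) * fst (y n) $ i)"
    using choice[of "\<lambda>n y. (\<forall>i. fst y $ i > 0) \<and> (\<Sum>i\<in>UNIV. fst y $ i) = 1 \<and>
      (\<forall>i. (\<Sum>j\<in>UNIV. (A $ i $ j + d n) * fst y $ j) = snd y * fst y $ i)"] by blast
  define x r where "x n = fst (y n)" and "r n = snd (y n)" for n
  have x: "\<And>n i. x n $ i > 0" "\<And>n. (\<Sum>i\<in>UNIV. x n $ i) = 1"
      "\<And>n i. (\<Sum>j\<in>UNIV. (A $ i $ j + d n) * x n $ j) = r n * x n $ i"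
    using y by (auto simp: x_def r_def)
  have x_le: "x n $ i \<le> 1" for n i
    using member_le_sum[of i UNIV "\<lambda>i. x n $ i"] x(1)[of n] x(2)[of n] by (auto intro: less_imp_le)
  define C where "C = (\<Sum>i\<in>UNIV. \<Sum>j\<in>UNIV. \<bar>A $ i $ j\<bar> + 1)"
  have r_bound: "\<bar>r n\<bar> \<le> C" for n
  proof -
    \<comment> \<open>Since the entries of \<open>x n\<close> sum to 1, the eigenvalue is the sum of
      all entries of the image vector, which the entries of the matrix bound.\<close>
    have "r n = (\<Sum>i\<in>UNIV. r n * x n $ i)" using x(2)[of n] by (simp flip: sum_distrib_left)
    also have "\<dots> = (\<Sum>i\<in>UNIV. \<Sum>j\<in>UNIV. (A $ i $ j + d n) * x n $ j)" by (simp add: x(3))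
    also have "\<bar>\<dots>\<bar> \<le> (\<Sum>i\<in>UNIV. \<Sum>j\<in>UNIV. \<bar>(A $ i $ j + d n) * x n $ j\<bar>)"
      by (intro order.trans[OF sum_abs] sum_mono order_refl)
    also have "\<dots> \<le> (\<Sum>i\<in>UNIV. \<Sum>j\<in>UNIV. (\<bar>A $ i $ j\<bar> + 1) * 1)"
    proof (intro sum_mono)
      fix i j
      show "\<bar>(A $ i $ j + d n) * x n $ j\<bar> \<le> (\<bar>A $ i $ j\<bar> + 1) * 1"
        unfolding abs_mult using x_le[of n j] x(1)[of n j] d_pos[of n] d_le[of n]
        by (intro mult_mono) auto
    qed
    finally show ?thesis by (simp add: C_def)
  qed
  have "bounded (range (\<lambda>n. (x n, r n)))"
  proof -
    have "norm (x n) \<le> 1" for n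
      using norm_le_l1_cart[of "x n"] x(1)[of n] x(2)[of n] by (simp add: abs_of_pos)
    then have "norm (x n, r n) \<le> 1 + C" for n
      by (intro order.trans[OF norm_Pair_le] add_mono) (use r_bound[of n] in auto)
    then show ?thesis by (auto simp: bounded_iff)
  qed
  then obtain l \<sigma> where \<sigma>: "strict_mono (\<sigma> :: nat \<Rightarrow> nat)" and "((\<lambda>n. (x n, r n)) \<circ> \<sigma>) \<longlonglongrightarrow> l"
    by (auto dest: bounded_imp_convergent_subsequence)
  then obtain y L where "(\<lambda>n. (x (\<sigma> n), r (\<sigma> n))) \<longlonglongrightarrow> (y, L)" by (cases l) (auto simp: o_def)
  then have y: "(\<lambda>n. x (\<sigma> n)) \<longlonglongrightarrow> y" and r: "(\<lambda>n. r (\<sigma> n)) \<longlonglongrightarrow> L"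
    by (auto dest: tendsto_fst tendsto_snd)
  have d\<sigma>: "(\<lambda>n. d (\<sigma> n)) \<longlonglongrightarrow> 0" using LIMSEQ_subseq_LIMSEQ[OF d_lim \<sigma>] by (simp add: o_def)
  have "(\<Sum>j\<in>UNIV. (A $ i $ j + 0) * y $ j) = L * y $ i" for i
  proof (rule LIMSEQ_unique)
    show "(\<lambda>n. \<Sum>j\<in>UNIV. (A $ i $ j + d (\<sigma> n)) * x (\<sigma> n) $ j) \<longlonglongrightarrow> (\<Sum>j\<in>UNIV. (A $ i $ j + 0) * y $ j)"
      by (intro tendsto_intros d\<sigma> y)
    show "(\<lambda>n. \<Sum>j\<in>UNIV. (A $ i $ j + d (\<sigma> n)) * x (\<sigma> n) $ j) \<longlonglongrightarrow> L * y $ i"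
      unfolding x(3) by (intro tendsto_intros r y)
  qed
  then have Ay: "(\<Sum>j\<in>UNIV. A $ i $ j * y $ j) = L * y $ i" for i by simp
  have "(\<Sum>i\<in>UNIV. y $ i) = 1"
  proof (rule LIMSEQ_unique)
    show "(\<lambda>n. \<Sum>i\<in>UNIV. x (\<sigma> n) $ i) \<longlonglongrightarrow> (\<Sum>i\<in>UNIV. y $ i)" by (intro tendsto_intros y)
  qed (simp add: x(2))
  then have "y \<noteq> 0" by auto
  then have "(\<chi> i. complex_of_real (y $ i)) \<noteq> 0" by (auto simp: vec_eq_iff)
  moreover have "map_matrix complex_of_real A *v (\<chi> i. complex_of_real (y $ i))
      = complex_of_real L *s (\<chi> i. complex_of_real (y $ i))"
    by (simp add: vec_eq_iff matrix_vector_mult_def Ay flip: of_real_mult of_real_sum)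
  ultimately have ev: "complex_eigenvalue A (complex_of_real L)"
    unfolding complex_eigenvalue_def by blast
  \<comment> \<open>Dropping the positive perturbation only lowers the row sums, so
    \<open>x n\<close> is a subeigenvector of \<open>A\<close> itself for the value
    \<open>r n\<close>.\<close>
  have le_r: "Re \<mu> \<le> r n" if "complex_eigenvalue A \<mu>" for \<mu> n
  proof (rule metzler_eigenvalue_le[OF A _ _ that])
    show "(\<Sum>j\<in>UNIV. A $ i $ j * x n $ j) \<le> r n * x n $ i" for i
      unfolding x(3)[symmetric] using d_pos[of n] x(1)[of n]
      by (intro sum_mono mult_right_mono) (auto intro: less_imp_le)
  qed (rule x(1))
  have le: "Re \<mu> \<le> L" if "complex_eigenvalue A \<mu>" for \<mu>
    using le_r[OF that] by (intro LIMSEQ_le_const[OF r]) auto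
  have "lambda_max A = L"
    unfolding lambda_max_def
    using ev le by (intro the_equality) (use le[of "complex_of_real _"] in \<open>auto intro!: antisym\<close>)
  \<comment> \<open>The limit \<open>y\<close> may have zero entries and comes with no slack, so the
    witnesses are taken before the limit: a positive \<open>x (\<sigma> n)\<close> with
    \<open>d (\<sigma> n) > 0\<close>, for an index at which the eigenvalue is already below
    \<open>\<rho>\<close>.\<close>
  then have "eventually (\<lambda>n. r (\<sigma> n) < \<rho>) sequentially" using \<rho> by (intro order_tendstoD(2)[OF r]) simp
  then obtain n where n: "r (\<sigma> n) < \<rho>" by (auto simp: eventually_sequentially)
  show ?thesis
  proof (rule that[of "d (\<sigma> n)" "\<lambda>i. x (\<sigma> n) $ i"])
    show "(\<Sum>j\<in>UNIV. (A $ i $ j + d (\<sigma> n)) * x (\<sigma> n) $ j) \<le> \<rho> * x (\<sigma> n) $ i" for i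
      unfolding x(3) using n x(1)[of "\<sigma> n" i] by (intro mult_right_mono) auto
  qed (use d_pos x(1) in auto)
qed

section \<open>Growth of weighted maximum norms\<close>

text \<open>If \<open>g\<close> rose, it would still rise after subtracting a small slope. Just
  after the last time at which the tilted function is at most a suitable level, the Dini bound keeps
  it there, while maximality of that time pushes it above. The countable set \<open>D\<close>
  accommodates the times at which the differential equation fails.\<close>

lemma continuous_right_dini_nonincreasing:
  fixes g :: "real \<Rightarrow> real"
  assumes "a \<le> b" and cont: "continuous_on {a..b} g" and D: "countable D"
    and dini: "\<And>t \<eta>. t \<in> {a..<b} - D \<Longrightarrow> \<eta> > 0 \<Longrightarrow>
      eventually (\<lambda>s. g s \<le> g t + \<eta> * (s - t)) (at_right t)"
  shows "g b \<le> g a"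
proof (rule ccontr)
  assume "\<not> g b \<le> g a"
  then have ab: "a < b" and gab: "g a < g b" using \<open>a \<le> b\<close> by (auto simp: not_le less_le)
  then have "0 < (g b - g a) / (b - a)" by simp
  \<comment> \<open>A slope below the mean slope of \<open>g\<close> keeps the tilted function
    \<open>h\<close> larger at \<open>b\<close> than at \<open>a\<close>.\<close>
  then obtain \<eta> where \<eta>: "\<eta> > 0" "\<eta> < (g b - g a) / (b - a)" using dense by blast
  define h where "h s = g s - \<eta> * (s - a)" for s
  have "\<eta> * (b - a) < g b - g a" using \<eta>(2) ab pos_less_divide_eq[of "b - a"] by simp
  then have "h a < h b" by (simp add: h_def)
  have h_cont: "continuous_on {a..b} h" unfolding h_def by (intro continuous_intros cont)
  \<comment> \<open>A level missed by \<open>h ` D\<close> is last attained at a time outside \<open>D\<close>, where the derivative bound holds.\<close>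
  obtain c where c: "c \<in> {h a<..<h b}" "c \<notin> h ` D"
    using real_interval_avoid_countable_set[OF \<open>h a < h b\<close> countable_image[OF D, of h]] by blast
  define S where "S = {t \<in> {a..b}. h t \<le> c}"
  have "closed S"
    unfolding S_def by (intro continuous_on_closed_Collect_le h_cont continuous_intros closed_atLeastAtMost)
  moreover have "a \<in> S" using c ab by (auto simp: S_def)
  moreover have bdd: "bdd_above S" by (auto simp: S_def bdd_above_def)
  ultimately have "Sup S \<in> S" by (intro closed_contains_Sup) auto
  define \<tau> where "\<tau> = Sup S"
  have above: "h s > c" if "s \<in> {\<tau><..b}" for s
  proof (rule ccontr)
    assume "\<not> h s > c"
    then have "s \<in> S" using that \<open>Sup S \<in> S\<close> by (auto simp: S_def \<tau>_def)
    then show False using that cSup_upper[OF _ bdd, of s] by (auto simp: \<tau>_def)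
  qed
  have \<tau>: "a \<le> \<tau>" "\<tau> \<le> b" "h \<tau> \<le> c" using \<open>Sup S \<in> S\<close> by (auto simp: S_def \<tau>_def)
  then have "\<tau> < b" using c by (cases "\<tau> = b") auto
  have "h \<tau> = c"
  proof -
    obtain s where s: "\<tau> \<le> s" "s \<le> b" "h s = c"
      using IVT'[of h \<tau> c b] \<tau> c continuous_on_subset[OF h_cont, of "{\<tau>..b}"] by auto
    then show ?thesis using above[of s] by (cases "s = \<tau>") auto
  qed
  then have "\<tau> \<in> {a..<b} - D" using \<tau> \<open>\<tau> < b\<close> c by auto
  from dini[OF this \<eta>(1)] obtain d where d: "d > \<tau>" "\<And>s. \<tau> < s \<Longrightarrow> s < d \<Longrightarrow> g s \<le> g \<tau> + \<eta> * (s - \<tau>)"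
    by (auto simp: eventually_at_right_field)
  obtain s where s: "\<tau> < s" "s < min d b" using dense[of \<tau> "min d b"] d(1) \<open>\<tau> < b\<close> by auto
  then have "h s \<le> h \<tau>" using d(2)[of s] by (simp add: h_def algebra_simps)
  then show False using above[of s] s \<open>h \<tau> = c\<close> by auto
qed

lemma infnorm_cart_le_iff:
  fixes x :: "real^'n"
  shows "infnorm x \<le> m \<longleftrightarrow> (\<forall>i. \<bar>x $ i\<bar> \<le> m)"
proof
  assume "infnorm x \<le> m"
  then show "\<forall>i. \<bar>x $ i\<bar> \<le> m" using component_le_infnorm_cart[of x] order.trans by blast
next
  assume "\<forall>i. \<bar>x $ i\<bar> \<le> m"
  then show "infnorm x \<le> m" unfolding infnorm_cart by (intro cSup_least) auto
qed

text \<open>The maximum of finitely many functions grows to first order only through those attaining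
  it. Hence \<open>ineq\<close> is demanded only for a component \<open>i\<close> and sign
  \<open>\<sigma>\<close> at which \<open>\<sigma> * w t $ i / p i\<close> equals the weighted
  maximum norm.\<close>

lemma weighted_max_norm_growth:
  fixes w w' :: "real \<Rightarrow> real^'n"
  assumes "a \<le> b" and cont: "continuous_on {a..b} w" and D: "countable D"
    and der: "\<And>t. t \<in> {a..<b} - D \<Longrightarrow> (w has_vector_derivative w' t) (at_right t)"
    and p: "\<And>i. p i > 0"
    and ineq: "\<And>t i \<sigma>. t \<in> {a..<b} - D \<Longrightarrow> \<bar>\<sigma>\<bar> = 1 \<Longrightarrow>
      (\<And>j. \<bar>w t $ j\<bar> * p i \<le> \<sigma> * w t $ i * p j) \<Longrightarrow> \<sigma> * w' t $ i \<le> \<rho> * (\<sigma> * w t $ i)"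
    and init: "\<And>i. \<bar>w a $ i\<bar> \<le> c * p i"
  shows "\<bar>w b $ i\<bar> \<le> c * p i * exp (\<rho> * (b - a))"
proof -
  \<comment> \<open>In weighted coordinates and discounted by the expected growth, the claim becomes
    that \<open>infnorm (u t)\<close> does not increase.\<close>
  define u :: "real \<Rightarrow> real^'n" where "u t = (\<chi> i. w t $ i / p i * exp (- \<rho> * (t - a)))" for t
  have "infnorm (u b) \<le> infnorm (u a)"
  proof (rule continuous_right_dini_nonincreasing[OF \<open>a \<le> b\<close> _ D])
    have "continuous_on {a..b} u"
      unfolding u_def using p by (intro continuous_intros cont) (simp add: less_imp_neq[symmetric])
    then show "continuous_on {a..b} (\<lambda>t. infnorm (u t))"
      by (rule continuous_on_infnorm)
  next
    fix t \<eta> :: real assume t: "t \<in> {a..<b} - D" and \<eta>: "\<eta> > 0"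
    \<comment> \<open>A signed component below the maximum at \<open>t\<close> stays below it for a
      while by continuity; one attaining the maximum has right derivative \<open>d \<le> 0\<close>
      by \<open>ineq\<close>.\<close>
    have comp: "eventually (\<lambda>s. \<sigma> * u s $ i \<le> infnorm (u t) + \<eta> * (s - t)) (at_right t)"
      if \<sigma>: "\<bar>\<sigma>\<bar> = 1" for \<sigma> i
    proof -
      have "((\<lambda>t. w t $ i) has_vector_derivative w' t $ i) (at_right t)"
        using bounded_linear.has_vector_derivative[OF bounded_linear_vec_nth der[OF t]] .
      then have wi: "((\<lambda>t. w t $ i) has_real_derivative w' t $ i) (at_right t)"
        by (simp add: has_real_derivative_iff_has_vector_derivative)
      define d where "d = (\<sigma> * w' t $ i - \<rho> * (\<sigma> * w t $ i)) / p i * exp (- \<rho> * (t - a))"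
      have v: "((\<lambda>s. \<sigma> * u s $ i) has_real_derivative d) (at_right t)"
      proof -
        have "((\<lambda>s. \<sigma> * (w s $ i / p i * exp (- \<rho> * (s - a)))) has_real_derivative d) (at_right t)"
          unfolding d_def using p[of i]
          by (auto intro!: derivative_eq_intros wi simp: field_simps)
        then show ?thesis by (simp add: u_def)
      qed
      have le: "\<sigma> * u t $ i \<le> infnorm (u t)"
      proof -
        have "\<sigma> * u t $ i \<le> \<bar>\<sigma> * u t $ i\<bar>" by simp
        also have "\<dots> \<le> infnorm (u t)" using component_le_infnorm_cart[of "u t" i] \<sigma> by (simp add: abs_mult)
        finally show ?thesis .
      qed
      show ?thesis
      proof (cases "\<sigma> * u t $ i < infnorm (u t)")
        case True
        have "((\<lambda>s. \<sigma> * u s $ i) \<longlongrightarrow> \<sigma> * u t $ i) (at_right t)"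
          using has_field_derivative_imp_has_derivative[OF v, THEN has_derivative_continuous]
          by (simp add: continuous_within)
        then have "eventually (\<lambda>s. \<sigma> * u s $ i < infnorm (u t)) (at_right t)"
          using True by (rule order_tendstoD(2))
        moreover have "eventually (\<lambda>s. s > t) (at_right t)" by (simp add: eventually_at_right_less)
        ultimately show ?thesis
          by eventually_elim (use \<eta> in \<open>auto intro: add_increasing2 less_imp_le\<close>)
      next
        case False
        with le have eq: "\<sigma> * u t $ i = infnorm (u t)" by simp
        have "\<bar>w t $ j\<bar> * p i \<le> \<sigma> * w t $ i * p j" for j
        proof -
          have "\<bar>u t $ j\<bar> \<le> \<sigma> * u t $ i" unfolding eq by (rule component_le_infnorm_cart)
          then show ?thesis using p[of i] p[of j] by (simp add: u_def abs_mult field_simps)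
        qed
        from ineq[OF t \<sigma> this] have "d \<le> 0"
          unfolding d_def using p[of i] by (simp add: divide_nonpos_pos mult_nonpos_nonneg)
        \<comment> \<open>The slope \<open>\<eta>\<close> turns \<open>d \<le> 0\<close> into a
          strictly negative derivative, which forces a decrease to the right of
          \<open>t\<close>.\<close>
        have "((\<lambda>s. \<sigma> * u s $ i - \<eta> * (s - t)) has_real_derivative d - \<eta>) (at_right t)"
          by (rule DERIV_diff[OF v]) (auto intro!: derivative_eq_intros)
        from has_real_derivative_neg_dec_right[OF this] \<open>d \<le> 0\<close> \<eta>
        obtain e where e: "e > 0" "\<And>h. h > 0 \<Longrightarrow> h < e \<Longrightarrow> \<sigma> * u (t + h) $ i - \<eta> * h < \<sigma> * u t $ i"
          by auto
        show ?thesis unfolding eventually_at_right_field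
        proof (intro exI conjI allI impI)
          show "t + e > t" using e by simp
          fix s assume "t < s" "s < t + e"
          then show "\<sigma> * u s $ i \<le> infnorm (u t) + \<eta> * (s - t)"
            using e(2)[of "s - t"] eq by simp
        qed
      qed
    qed
    have "eventually (\<lambda>s. \<forall>i. 1 * u s $ i \<le> infnorm (u t) + \<eta> * (s - t) \<and>
        -1 * u s $ i \<le> infnorm (u t) + \<eta> * (s - t)) (at_right t)"
      by (intro eventually_all_finite eventually_conj comp) auto
    then show "eventually (\<lambda>s. infnorm (u s) \<le> infnorm (u t) + \<eta> * (s - t)) (at_right t)"
      by eventually_elim (simp add: infnorm_cart_le_iff abs_le_iff)
  qed
  also have "infnorm (u a) \<le> c"
    using init p by (simp add: infnorm_cart_le_iff u_def abs_of_pos pos_divide_le_eq)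
  finally have "\<bar>u b $ i\<bar> \<le> c" by (simp add: infnorm_cart_le_iff)
  then have "\<bar>w b $ i\<bar> / p i / exp (\<rho> * (b - a)) \<le> c"
    using p[of i] by (simp add: u_def abs_mult exp_minus divide_inverse)
  then show ?thesis using p[of i] by (simp add: pos_divide_le_eq mult_ac)
qed

section \<open>Solutions and their dependence on the initial state\<close>

text \<open>Compactness yields finitely many product neighbourhoods with a Lipschitz constant each.
  Two points of the ball may lie in different ones, so the estimate is assembled along the segment
  joining them, which stays in the convex ball.\<close>

lemma local_lipschitz_uniform_on_cball:
  fixes f :: "'t::metric_space \<Rightarrow> 'a::euclidean_space \<Rightarrow> 'b::real_normed_vector"
  assumes f: "local_lipschitz S UNIV f" and T: "compact T" "T \<subseteq> S"
  obtains L where "L \<ge> 0"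
    "\<And>t x y. t \<in> T \<Longrightarrow> x \<in> cball 0 R \<Longrightarrow> y \<in> cball 0 R \<Longrightarrow> norm (f t x - f t y) \<le> L * norm (x - y)"
proof -
  have "\<forall>z\<in>T \<times> cball 0 R. \<exists>p. fst p > 0 \<and>
      (\<forall>t \<in> cball (fst z) (fst p) \<inter> S. (snd p)-lipschitz_on (cball (snd z) (fst p)) (f t))"
  proof
    fix z assume "z \<in> T \<times> cball (0::'a) R"
    then have "fst z \<in> S" using T(2) by auto
    then have "\<exists>u>0. \<exists>l. \<forall>t \<in> cball (fst z) u \<inter> S. l-lipschitz_on (cball (snd z) u) (f t)"
      using f by (simp add: local_lipschitz_def)
    then obtain u l where "u > 0" "\<forall>t \<in> cball (fst z) u \<inter> S. l-lipschitz_on (cball (snd z) u) (f t)"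
      by blast
    then show "\<exists>p. fst p > 0 \<and>
        (\<forall>t \<in> cball (fst z) (fst p) \<inter> S. (snd p)-lipschitz_on (cball (snd z) (fst p)) (f t))"
      by (intro exI[of _ "(u, l)"]) simp
  qed
  from bchoice[OF this] obtain p where p: "\<forall>z\<in>T \<times> cball 0 R. fst (p z) > 0 \<and>
      (\<forall>t \<in> cball (fst z) (fst (p z)) \<inter> S. (snd (p z))-lipschitz_on (cball (snd z) (fst (p z))) (f t))" ..
  define u l where "u z = fst (p z)" and "l z = snd (p z)" for z
  have u: "\<And>z. z \<in> T \<times> cball 0 R \<Longrightarrow> u z > 0"
    and l: "\<And>z t. z \<in> T \<times> cball 0 R \<Longrightarrow> t \<in> cball (fst z) (u z) \<inter> S \<Longrightarrow>
      (l z)-lipschitz_on (cball (snd z) (u z)) (f t)"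
    using p unfolding u_def l_def by blast+
  have "compact (T \<times> cball (0::'a) R)" using T(1) by (intro compact_Times compact_cball)
  moreover have "open (ball (fst z) (u z) \<times> ball (snd z) (u z))" for z by (intro open_Times open_ball)
  moreover have "T \<times> cball 0 R \<subseteq> (\<Union>z\<in>T \<times> cball 0 R. ball (fst z) (u z) \<times> ball (snd z) (u z))"
  proof
    fix z assume "z \<in> T \<times> cball (0::'a) R"
    then show "z \<in> (\<Union>z\<in>T \<times> cball 0 R. ball (fst z) (u z) \<times> ball (snd z) (u z))"
      using u by (intro UN_I[of z]) (auto simp: mem_Times_iff)
  qed
  ultimately obtain C where C: "C \<subseteq> T \<times> cball 0 R" "finite C"
    "T \<times> cball 0 R \<subseteq> (\<Union>z\<in>C. ball (fst z) (u z) \<times> ball (snd z) (u z))"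
    by (rule compactE_image)
  define L where "L = (\<Sum>z\<in>C. \<bar>l z\<bar>)"
  have L: "l z \<le> L" if "z \<in> C" for z
    using member_le_sum[of z C "\<lambda>z. \<bar>l z\<bar>"] that C(2) by (simp add: L_def)
  have "L \<ge> 0" by (auto simp: L_def intro: sum_nonneg)
  moreover have "norm (f t x - f t y) \<le> L * norm (x - y)"
    if t: "t \<in> T" and xy: "x \<in> cball 0 R" "y \<in> cball 0 R" for t x y
  proof -
    \<comment> \<open>The sets \<open>U z\<close> with \<open>z \<in> I\<close> are closed sets of
      segment parameters, one for each neighbourhood that contains the time \<open>t\<close>; they
      cover \<open>{0..1}\<close>, so the Lipschitz bounds on them combine.\<close>
    define \<gamma> where "\<gamma> s = y + s *\<^sub>R (x - y)" for s :: real
    define U where "U z = \<gamma> -` cball (snd z) (u z)" for z :: "'t \<times> 'a"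
    define I where "I = {z \<in> C. t \<in> ball (fst z) (u z)}"
    have "(L * norm (x - y))-lipschitz_on {0..1} (\<lambda>s. f t (\<gamma> s))"
    proof (rule lipschitz_on_closed_Union)
      fix z assume z: "z \<in> I"
      have "(l z)-lipschitz_on (cball (snd z) (u z)) (f t)"
        using z t C(1) T(2) by (intro l) (auto simp: I_def)
      then have lip: "L-lipschitz_on (cball (snd z) (u z)) (f t)"
        by (rule lipschitz_on_mono) (use L z in \<open>auto simp: I_def\<close>)
      show "(L * norm (x - y))-lipschitz_on (U z) (\<lambda>s. f t (\<gamma> s))"
      proof (rule lipschitz_onI)
        fix r s assume "r \<in> U z" "s \<in> U z"
        then have "dist (f t (\<gamma> r)) (f t (\<gamma> s)) \<le> L * dist (\<gamma> r) (\<gamma> s)"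
          by (intro lipschitz_onD[OF lip]) (auto simp: U_def)
        also have "\<gamma> r - \<gamma> s = (r - s) *\<^sub>R (x - y)" by (simp add: \<gamma>_def algebra_simps)
        then have "dist (\<gamma> r) (\<gamma> s) = dist r s * norm (x - y)" by (simp add: dist_norm)
        finally show "dist (f t (\<gamma> r)) (f t (\<gamma> s)) \<le> L * norm (x - y) * dist r s" by (simp add: mult_ac)
      qed (use \<open>L \<ge> 0\<close> in simp)
      show "closed (U z)" unfolding U_def \<gamma>_def by (intro closed_vimage continuous_intros closed_cball)
    next
      show "finite I" using C(2) by (simp add: I_def)
      show "0 \<le> L * norm (x - y)" using \<open>L \<ge> 0\<close> by simp
      show "{0..1} \<subseteq> (\<Union>z\<in>I. U z)"
      proof
        fix s :: real assume s: "s \<in> {0..1}"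
        have "(1 - s) *\<^sub>R y + s *\<^sub>R x \<in> cball 0 R"
          using convexD_alt[OF convex_cball xy(2,1), of s] s by simp
        then have "\<gamma> s \<in> cball 0 R" by (simp add: \<gamma>_def algebra_simps)
        then have "(t, \<gamma> s) \<in> T \<times> cball 0 R" using t by simp
        then have "(t, \<gamma> s) \<in> (\<Union>z\<in>C. ball (fst z) (u z) \<times> ball (snd z) (u z))" using C(3) by blast
        then show "s \<in> (\<Union>z\<in>I. U z)" by (fastforce simp: I_def U_def)
      qed
    qed
    from lipschitz_onD[OF this, of 1 0] show ?thesis by (simp add: \<gamma>_def dist_norm)
  qed
  ultimately show ?thesis by (rule that)
qed

lemma solution_difference:
  assumes \<phi>: "solution_from f t0 x \<phi>" and \<psi>: "solution_from f t0 y \<psi>" and "t0 \<le> a"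
  obtains D where "countable D" "continuous_on {a..b} (\<lambda>t. \<phi> t - \<psi> t)"
    "\<And>t. t \<in> {a..<b} - D \<Longrightarrow>
      ((\<lambda>t. \<phi> t - \<psi> t) has_vector_derivative f t (\<phi> t) - f t (\<psi> t)) (at_right t)"
proof -
  obtain D where D: "countable D"
    "\<And>t. t \<in> {t0..} - D \<Longrightarrow> (\<phi> has_vector_derivative f t (\<phi> t)) (at t within {t0..})"
    using \<phi> unfolding solution_from_def by blast
  obtain D' where D': "countable D'"
    "\<And>t. t \<in> {t0..} - D' \<Longrightarrow> (\<psi> has_vector_derivative f t (\<psi> t)) (at t within {t0..})"
    using \<psi> unfolding solution_from_def by blast
  show ?thesis
  proof (rule that[of "D \<union> D'"])
    show "countable (D \<union> D')" using D(1) D'(1) by simp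
    have "{a..b} \<subseteq> {t0..}" using \<open>t0 \<le> a\<close> by auto
    then show "continuous_on {a..b} (\<lambda>t. \<phi> t - \<psi> t)"
      using \<phi> \<psi> unfolding solution_from_def by (intro continuous_on_diff) (auto intro: continuous_on_subset)
    fix t assume t: "t \<in> {a..<b} - (D \<union> D')"
    then have "((\<lambda>t. \<phi> t - \<psi> t) has_vector_derivative f t (\<phi> t) - f t (\<psi> t)) (at t within {t0..})"
      using \<open>t0 \<le> a\<close> by (intro has_vector_derivative_diff D(2) D'(2)) auto
    then show "((\<lambda>t. \<phi> t - \<psi> t) has_vector_derivative f t (\<phi> t) - f t (\<psi> t)) (at_right t)"
      by (rule has_vector_derivative_within_subset) (use t \<open>t0 \<le> a\<close> in auto)
  qed
qed

text \<open>Gronwall's estimate from the growth lemma with all weights 1. Passing between the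
  maximum norm and the Euclidean norm costs \<open>CARD('n)\<close>, once in the rate and once in
  the prefactor. The Lipschitz bound is only needed along the two trajectories, so \<open>L\<close>
  may come from a ball containing both.\<close>

lemma solution_difference_gronwall:
  fixes f :: "real \<Rightarrow> real^'n \<Rightarrow> real^'n"
  assumes \<phi>: "solution_from f t0 x \<phi>" and \<psi>: "solution_from f t0 y \<psi>" and "t0 \<le> t" "L \<ge> 0"
    and lip: "\<And>s. s \<in> {t0..<t} \<Longrightarrow> norm (f s (\<phi> s) - f s (\<psi> s)) \<le> L * norm (\<phi> s - \<psi> s)"
  shows "norm (\<phi> t - \<psi> t) \<le> real CARD('n) * exp (L * real CARD('n) * (t - t0)) * norm (x - y)"
proof -
  define w where "w s = \<phi> s - \<psi> s" for s
  define w' where "w' s = f s (\<phi> s) - f s (\<psi> s)" for s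
  obtain D where D: "countable D" "continuous_on {t0..t} w"
    "\<And>s. s \<in> {t0..<t} - D \<Longrightarrow> (w has_vector_derivative w' s) (at_right s)"
    unfolding w_def w'_def by (rule solution_difference[OF \<phi> \<psi> order_refl]) blast
  have w0: "w t0 = x - y" using \<phi> \<psi> by (simp add: w_def solution_from_def)
  have "\<bar>w t $ i\<bar> \<le> norm (x - y) * 1 * exp (L * real CARD('n) * (t - t0))" for i
  proof (rule weighted_max_norm_growth[where p = "\<lambda>_. 1", OF \<open>t0 \<le> t\<close> D(2,1,3)])
    show "\<bar>w t0 $ i\<bar> \<le> norm (x - y) * 1" for i unfolding w0 using component_le_norm_cart[of "x - y" i] by simp
    fix s i and \<sigma> :: real assume s: "s \<in> {t0..<t} - D" and \<sigma>: "\<bar>\<sigma>\<bar> = 1"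
      and max: "\<And>j. \<bar>w s $ j\<bar> * 1 \<le> \<sigma> * w s $ i * 1"
    have "\<sigma> * w' s $ i \<le> \<bar>\<sigma> * w' s $ i\<bar>" by simp
    also have "\<dots> = \<bar>w' s $ i\<bar>" using \<sigma> by (simp add: abs_mult)
    also have "\<dots> \<le> norm (w' s)" by (rule component_le_norm_cart)
    also have "\<dots> \<le> L * norm (w s)" using lip[of s] s by (simp add: w_def w'_def)
    also have "norm (w s) \<le> (\<Sum>j\<in>UNIV. \<bar>w s $ j\<bar>)" by (rule norm_le_l1_cart)
    also have "\<dots> \<le> (\<Sum>j\<in>(UNIV::'n set). \<sigma> * w s $ i)" by (rule sum_mono) (use max in simp)
    finally show "\<sigma> * w' s $ i \<le> L * real CARD('n) * (\<sigma> * w s $ i)"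
      using \<open>L \<ge> 0\<close> by (simp add: mult_left_mono)
  qed auto
  then have "(\<Sum>i\<in>UNIV. \<bar>w t $ i\<bar>) \<le> (\<Sum>i\<in>(UNIV::'n set). norm (x - y) * exp (L * real CARD('n) * (t - t0)))"
    by (intro sum_mono) simp
  with norm_le_l1_cart[of "w t"] show ?thesis by (simp add: w_def mult_ac)
qed

lemma solution_bounded:
  assumes "solution_from f t0 x \<phi>"
  obtains R where "R \<ge> 0" "\<And>s. s \<in> {t0..t} \<Longrightarrow> norm (\<phi> s) \<le> R"
proof -
  have "continuous_on {t0..t} \<phi>"
    using assms unfolding solution_from_def by (auto intro: continuous_on_subset)
  then have "bounded (\<phi> ` {t0..t})" by (intro compact_imp_bounded compact_continuous_image) auto
  then obtain R where "R > 0" "\<forall>z\<in>\<phi> ` {t0..t}. norm z \<le> R" unfolding bounded_pos by blast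
  then show ?thesis by (intro that[of R]) auto
qed

lemma solution_unique:
  fixes f :: "real \<Rightarrow> real^'n \<Rightarrow> real^'n"
  assumes f: "local_lipschitz {t0..} UNIV f"
    and \<phi>: "solution_from f t0 x \<phi>" and \<psi>: "solution_from f t0 x \<psi>" and "t0 \<le> t"
  shows "\<phi> t = \<psi> t"
proof -
  obtain R1 where R1: "\<And>s. s \<in> {t0..t} \<Longrightarrow> norm (\<phi> s) \<le> R1" by (rule solution_bounded[OF \<phi>]) blast
  obtain R2 where R2: "\<And>s. s \<in> {t0..t} \<Longrightarrow> norm (\<psi> s) \<le> R2" by (rule solution_bounded[OF \<psi>]) blast
  obtain L where L: "L \<ge> 0" "\<And>s x y. s \<in> {t0..t} \<Longrightarrow> x \<in> cball 0 (max R1 R2) \<Longrightarrow>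
      y \<in> cball 0 (max R1 R2) \<Longrightarrow> norm (f s x - f s y) \<le> L * norm (x - y)"
    by (rule local_lipschitz_uniform_on_cball[OF f, of "{t0..t}" "max R1 R2"]) auto
  have "norm (\<phi> t - \<psi> t) \<le> real CARD('n) * exp (L * real CARD('n) * (t - t0)) * norm (x - x)"
    by (rule solution_difference_gronwall[OF \<phi> \<psi> \<open>t0 \<le> t\<close> L(1)])
      (use R1 R2 in \<open>auto intro!: L(2) simp: le_max_iff_disj\<close>)
  then show ?thesis by simp
qed

text \<open>Uniqueness makes the description in \<open>xi\<close> denote the value of any solution
  at times from \<open>t0\<close> on, so \<open>xi\<close> inherits continuity and the differential
  equation.\<close>

lemma xi_solution:
  fixes f :: "real \<Rightarrow> real^'n \<Rightarrow> real^'n"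
  assumes f: "local_lipschitz {t0..} UNIV f" "forward_complete f t0"
  shows "solution_from f t0 x (\<lambda>t. xi f t t0 x)"
proof -
  obtain \<phi> where \<phi>: "solution_from f t0 x \<phi>" using f(2) unfolding forward_complete_def by blast
  have eq: "xi f t t0 x = \<phi> t" if "t \<ge> t0" for t
    unfolding xi_def using \<phi> solution_unique[OF f(1) _ \<phi> that] by (intro the_equality) blast+
  have "continuous_on {t0..} \<phi>" using \<phi> by (simp add: solution_from_def)
  then have "continuous_on {t0..} (\<lambda>t. xi f t t0 x)" by (rule continuous_on_eq) (simp add: eq)
  moreover obtain D where D: "countable D"
    "\<And>t. t \<in> {t0..} - D \<Longrightarrow> (\<phi> has_vector_derivative f t (\<phi> t)) (at t within {t0..})"
    using \<phi> unfolding solution_from_def by blast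
  have "((\<lambda>t. xi f t t0 x) has_vector_derivative f t (xi f t t0 x)) (at t within {t0..})"
    if t: "t \<in> {t0..} - D" for t
  proof (rule has_vector_derivative_transform)
    show "(\<phi> has_vector_derivative f t (xi f t t0 x)) (at t within {t0..})"
      using D(2)[OF t] eq t by simp
  qed (use t eq in auto)
  moreover have "xi f t0 t0 x = x" using eq[of t0] \<phi> by (simp add: solution_from_def)
  ultimately show ?thesis unfolding solution_from_def using D(1) by blast
qed

text \<open>A first-exit argument: until a nearby trajectory is at distance 1 from the one through
  \<open>x\<close>, both lie in \<open>cball 0 (R + 1)\<close>, where one Lipschitz constant
  applies; Gronwall's estimate then keeps the distance below 1 at the supposed exit time.\<close>

lemma xi_locally_bounded:
  fixes f :: "real \<Rightarrow> real^'n \<Rightarrow> real^'n"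
  assumes f: "local_lipschitz {t0..} UNIV f" "forward_complete f t0" and "t0 \<le> t1"
  obtains \<delta> R where "\<delta> > 0" "\<And>y t. y \<in> ball x \<delta> \<Longrightarrow> t \<in> {t0..t1} \<Longrightarrow> norm (xi f t t0 y) \<le> R"
proof -
  note sol = xi_solution[OF f]
  obtain R where R: "R \<ge> 0" "\<And>s. s \<in> {t0..t1} \<Longrightarrow> norm (xi f s t0 x) \<le> R"
    by (rule solution_bounded[OF sol]) blast
  obtain L where L: "L \<ge> 0" "\<And>s x y. s \<in> {t0..t1} \<Longrightarrow> x \<in> cball 0 (R + 1) \<Longrightarrow>
      y \<in> cball 0 (R + 1) \<Longrightarrow> norm (f s x - f s y) \<le> L * norm (x - y)"
    by (rule local_lipschitz_uniform_on_cball[OF f(1), of "{t0..t1}" "R + 1"]) auto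
  \<comment> \<open>The Gronwall factor over the whole interval; initial distances below
    \<open>1 / C\<close> therefore grow to less than 1.\<close>
  define C where "C = real CARD('n) * exp (L * real CARD('n) * (t1 - t0))"
  have C: "C > 0" by (simp add: C_def)
  have close: "norm (xi f t t0 x - xi f t t0 y) < 1" if y: "y \<in> ball x (1 / C)" and t: "t \<in> {t0..t1}" for y t
  proof (rule ccontr)
    define w where "w s = xi f s t0 x - xi f s t0 y" for s
    \<comment> \<open>\<open>Inf S\<close> is the first time at which the distance reaches 1; it
      belongs to \<open>S\<close> because \<open>S\<close> is closed.\<close>
    define S where "S = {s \<in> {t0..t1}. 1 \<le> norm (w s)}"
    have "continuous_on {t0..t1} w" unfolding w_def
      by (rule solution_difference[OF sol sol order_refl])
    then have "closed S" unfolding S_def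
      by (intro continuous_on_closed_Collect_le continuous_intros closed_atLeastAtMost)
    moreover assume "\<not> norm (xi f t t0 x - xi f t t0 y) < 1"
    then have "t \<in> S" using t by (simp add: S_def w_def)
    moreover have bdd: "bdd_below S" by (auto simp: S_def bdd_below_def)
    ultimately have "Inf S \<in> S" by (intro closed_contains_Inf) auto
    then have \<tau>: "Inf S \<in> {t0..t1}" "1 \<le> norm (w (Inf S))" by (auto simp: S_def)
    have "norm (w (Inf S)) \<le> real CARD('n) * exp (L * real CARD('n) * (Inf S - t0)) * norm (x - y)"
      unfolding w_def
    proof (rule solution_difference_gronwall[OF sol sol _ L(1)])
      fix s assume s: "s \<in> {t0..<Inf S}"
      then have "s \<notin> S" using cInf_lower[OF _ bdd, of s] by auto
      then have "norm (w s) \<le> 1" using s \<tau>(1) by (auto simp: S_def)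
      moreover have "norm (xi f s t0 x) \<le> R" using s \<tau>(1) by (intro R) auto
      ultimately have "norm (xi f s t0 y) \<le> R + 1"
        using norm_triangle_ineq4[of "xi f s t0 x" "w s"] by (simp add: w_def)
      then show "norm (f s (xi f s t0 x) - f s (xi f s t0 y)) \<le> L * norm (xi f s t0 x - xi f s t0 y)"
        using s \<tau>(1) \<open>norm (xi f s t0 x) \<le> R\<close> by (intro L(2)) auto
    qed (use \<tau> in auto)
    also have "\<dots> \<le> C * norm (x - y)" unfolding C_def
      using \<tau>(1) L(1) by (intro mult_right_mono mult_left_mono) (auto intro!: mult_left_mono)
    also have "\<dots> < C * (1 / C)" using y C by (intro mult_strict_left_mono) (auto simp: dist_norm)
    finally show False using \<tau>(2) C by simp
  qed
  show ?thesis
  proof (rule that[of "1 / C" "R + 1"])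
    fix y t assume y: "y \<in> ball x (1 / C)" and t: "t \<in> {t0..t1}"
    show "norm (xi f t t0 y) \<le> R + 1"
      using close[OF y t] R(2)[OF t] norm_triangle_ineq4[of "xi f t t0 x" "xi f t t0 x - xi f t t0 y"] by simp
  qed (use C in simp)
qed

text \<open>Finitely many of the local bounds cover \<open>K\<close>, so all trajectories from
  \<open>K\<close> stay in one ball up to \<open>t1\<close>; its Lipschitz constant and Gronwall's
  estimate finish the proof.\<close>

lemma xi_lipschitz_on_compact:
  fixes f :: "real \<Rightarrow> real^'n \<Rightarrow> real^'n"
  assumes f: "local_lipschitz {t0..} UNIV f" "forward_complete f t0" and "t0 \<le> t1" and K: "compact K"
  obtains M where "M > 0"
    "\<And>x y t. x \<in> K \<Longrightarrow> y \<in> K \<Longrightarrow> t \<in> {t0..t1} \<Longrightarrow> norm (xi f t t0 x - xi f t t0 y) \<le> M * norm (x - y)"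
proof -
  note sol = xi_solution[OF f]
  have "\<exists>\<delta> R. \<delta> > 0 \<and> (\<forall>y\<in>ball x \<delta>. \<forall>t\<in>{t0..t1}. norm (xi f t t0 y) \<le> R)" for x
    by (rule xi_locally_bounded[OF f \<open>t0 \<le> t1\<close>, of x]) blast
  then obtain \<delta> R where \<delta>: "\<And>x. \<delta> x > 0"
    and R: "\<And>x y t. y \<in> ball x (\<delta> x) \<Longrightarrow> t \<in> {t0..t1} \<Longrightarrow> norm (xi f t t0 y) \<le> R x"
    by metis
  have "K \<subseteq> (\<Union>x\<in>K. ball x (\<delta> x))" using \<delta> by (auto intro!: bexI)
  then obtain C where C: "C \<subseteq> K" "finite C" "K \<subseteq> (\<Union>x\<in>C. ball x (\<delta> x))"
    by (rule compactE_image[OF K, rotated]) auto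
  define r where "r = (\<Sum>x\<in>C. \<bar>R x\<bar>)"
  have bound: "norm (xi f t t0 y) \<le> r" if "y \<in> K" "t \<in> {t0..t1}" for y t
  proof -
    obtain x where x: "x \<in> C" "y \<in> ball x (\<delta> x)" using C(3) \<open>y \<in> K\<close> by blast
    have "norm (xi f t t0 y) \<le> R x" using x that by (intro R)
    also have "\<dots> \<le> r" using member_le_sum[of x C "\<lambda>x. \<bar>R x\<bar>"] x C(2) by (simp add: r_def)
    finally show ?thesis .
  qed
  obtain L where L: "L \<ge> 0" "\<And>s x y. s \<in> {t0..t1} \<Longrightarrow> x \<in> cball 0 r \<Longrightarrow>
      y \<in> cball 0 r \<Longrightarrow> norm (f s x - f s y) \<le> L * norm (x - y)"
    by (rule local_lipschitz_uniform_on_cball[OF f(1), of "{t0..t1}" r]) auto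
  show ?thesis
  proof (rule that[of "real CARD('n) * exp (L * real CARD('n) * (t1 - t0))"])
    fix x y t assume xy: "x \<in> K" "y \<in> K" and t: "t \<in> {t0..t1}"
    have "norm (xi f t t0 x - xi f t t0 y) \<le> real CARD('n) * exp (L * real CARD('n) * (t - t0)) * norm (x - y)"
      using t xy by (intro solution_difference_gronwall[OF sol sol _ L(1)] L(2)) (auto intro!: bound)
    also have "\<dots> \<le> real CARD('n) * exp (L * real CARD('n) * (t1 - t0)) * norm (x - y)"
      using t L(1) by (intro mult_right_mono mult_left_mono) (auto intro!: mult_left_mono)
    finally show "norm (xi f t t0 x - xi f t t0 y) \<le> real CARD('n) * exp (L * real CARD('n) * (t1 - t0)) * norm (x - y)" .
  qed simp
qed

section \<open>Exponential divergence of solutions\<close>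

lemma partial_deriv_eq:
  fixes g :: "real^'n \<Rightarrow> real^'n"
  assumes "(g has_derivative g') (at v)"
  shows "partial_deriv g i j v = g' (axis j 1) $ i"
proof -
  have lin: "linear g'" using assms by (rule has_derivative_linear)
  have "((\<lambda>s. v + s *\<^sub>R axis j 1) has_derivative (\<lambda>s. s *\<^sub>R axis j 1)) (at (0::real))"
    by (auto intro!: derivative_eq_intros)
  from has_derivative_compose[OF this, of g g'] assms
  have "((\<lambda>s. g (v + s *\<^sub>R axis j 1)) has_derivative (\<lambda>s. g' (s *\<^sub>R axis j 1))) (at (0::real))"
    by simp
  from bounded_linear.has_derivative[OF bounded_linear_vec_nth this, of i]
  have "((\<lambda>s. g (v + s *\<^sub>R axis j 1) $ i) has_derivative (\<lambda>s. g' (axis j 1) $ i * s)) (at (0::real))"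
    by (simp add: linear_scale[OF lin] mult.commute)
  then show ?thesis
    unfolding partial_deriv_def by (intro DERIV_imp_deriv) (simp add: has_field_derivative_def)
qed

text \<open>The mean value theorem holds only componentwise: the intermediate point \<open>v\<close>
  depends on \<open>i\<close>. That it lies on the segment is what brings in the convex hull of the
  reachable set.\<close>

lemma component_mvt:
  fixes g :: "real^'n \<Rightarrow> real^'n"
  assumes g: "\<And>v. g differentiable (at v)"
  obtains v where "v \<in> closed_segment y x"
    "g x $ i - g y $ i = (\<Sum>j\<in>UNIV. partial_deriv g i j v * (x $ j - y $ j))"
proof -
  define g' where "g' v = frechet_derivative g (at v)" for v
  have g': "(g has_derivative g' v) (at v)" for v
    using g[of v] by (simp add: g'_def frechet_derivative_works)
  have "((\<lambda>s. g (y + s *\<^sub>R (x - y)) $ i) has_derivative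
      (\<lambda>h. g' (y + s *\<^sub>R (x - y)) (h *\<^sub>R (x - y)) $ i)) (at s within {0..1})" for s :: real
  proof -
    have "((\<lambda>s. y + s *\<^sub>R (x - y)) has_derivative (\<lambda>h. h *\<^sub>R (x - y))) (at s within {0..1})"
      by (auto intro!: derivative_eq_intros)
    from has_derivative_compose[OF this g'] show ?thesis
      by (rule bounded_linear.has_derivative[OF bounded_linear_vec_nth])
  qed
  from mvt_very_simple[OF _ this]
  obtain s where s: "s \<in> {0..1}" "g x $ i - g y $ i = g' (y + s *\<^sub>R (x - y)) (x - y) $ i"
    by auto
  define v where "v = y + s *\<^sub>R (x - y)"
  have lin: "linear (g' v)" using g' by (rule has_derivative_linear)
  have "g' v (x - y) = g' v (\<Sum>j\<in>UNIV. ((x - y) $ j) *s axis j 1)" by (simp only: basis_expansion)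
  also have "\<dots> = (\<Sum>j\<in>UNIV. (x $ j - y $ j) *\<^sub>R g' v (axis j 1))"
    by (simp add: linear_sum[OF lin] linear_scale[OF lin] scalar_mult_eq_scaleR)
  finally have "g' v (x - y) $ i = (\<Sum>j\<in>UNIV. partial_deriv g i j v * (x $ j - y $ j))"
    by (simp add: partial_deriv_eq[OF g'] mult.commute)
  moreover have "v \<in> closed_segment y x"
    unfolding closed_segment_def v_def using s(1) by (auto simp: algebra_simps intro!: exI[of _ s])
  ultimately show ?thesis using s(2) by (intro that[of v]) (auto simp: v_def)
qed

text \<open>This verifies the hypothesis \<open>ineq\<close> of the growth lemma. In the component
  attaining the weighted maximum, the diagonal derivative multiplies a quantity of known sign, so a
  one-sided bound suffices; the other derivatives are bounded in absolute value, and the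
  subeigenvector inequality sums the row.\<close>

lemma signed_component_difference_le:
  fixes g :: "real^'n \<Rightarrow> real^'n" and A :: "real^'n^'n"
  assumes g: "\<And>v. g differentiable (at v)"
    and diag: "\<And>v i. v \<in> closed_segment y x \<Longrightarrow> partial_deriv g i i v \<le> A $ i $ i + d"
    and off: "\<And>v i j. v \<in> closed_segment y x \<Longrightarrow> i \<noteq> j \<Longrightarrow> \<bar>partial_deriv g i j v\<bar> \<le> A $ i $ j + d"
    and p: "\<And>i. p i > 0" and sub: "(\<Sum>j\<in>UNIV. (A $ i $ j + d) * p j) \<le> \<rho> * p i"
    and \<sigma>: "\<bar>\<sigma>\<bar> = 1"
    and max: "\<And>j. \<bar>(x - y) $ j\<bar> * p i \<le> \<sigma> * (x - y) $ i * p j"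
  shows "\<sigma> * (g x - g y) $ i \<le> \<rho> * (\<sigma> * (x - y) $ i)"
proof -
  define z where "z = x - y"
  \<comment> \<open>By \<open>max\<close>, \<open>m\<close> is the weighted maximum norm of
    \<open>z\<close>.\<close>
  define m where "m = \<sigma> * z $ i / p i"
  have zi: "\<sigma> * z $ i = m * p i" using p[of i] by (simp add: m_def)
  have zj: "\<bar>z $ j\<bar> \<le> m * p j" for j
    using max[of j] p[of i] by (simp add: m_def z_def pos_le_divide_eq)
  have "0 \<le> m * p i" using zj[of i] by (rule order.trans[OF abs_ge_zero])
  then have m: "0 \<le> m" using p[of i] by (simp add: zero_le_mult_iff)
  obtain v where v: "v \<in> closed_segment y x"
    "g x $ i - g y $ i = (\<Sum>j\<in>UNIV. partial_deriv g i j v * (x $ j - y $ j))"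
    using component_mvt[OF g] by blast
  have "\<sigma> * (g x - g y) $ i = (\<Sum>j\<in>UNIV. \<sigma> * (partial_deriv g i j v * z $ j))"
    using v(2) by (simp add: z_def sum_distrib_left)
  also have "\<dots> \<le> (\<Sum>j\<in>UNIV. m * ((A $ i $ j + d) * p j))"
  proof (rule sum_mono)
    fix j
    show "\<sigma> * (partial_deriv g i j v * z $ j) \<le> m * ((A $ i $ j + d) * p j)"
    proof (cases "i = j")
      case True
      have "\<sigma> * (partial_deriv g i j v * z $ j) = partial_deriv g i i v * (m * p i)"
        using True zi by (simp add: algebra_simps)
      also have "\<dots> \<le> (A $ i $ i + d) * (m * p i)"
        using diag[OF v(1)] m p[of i] by (intro mult_right_mono) auto
      finally show ?thesis using True by (simp add: mult_ac)
    next
      case False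
      have "\<sigma> * (partial_deriv g i j v * z $ j) \<le> \<bar>\<sigma> * (partial_deriv g i j v * z $ j)\<bar>" by simp
      also have "\<dots> = \<bar>partial_deriv g i j v\<bar> * \<bar>z $ j\<bar>" using \<sigma> by (simp add: abs_mult)
      also have "\<dots> \<le> (A $ i $ j + d) * (m * p j)"
        using off[OF v(1) False] zj[of j] by (intro mult_mono) auto
      finally show ?thesis by (simp add: mult_ac)
    qed
  qed
  also have "\<dots> = m * (\<Sum>j\<in>UNIV. (A $ i $ j + d) * p j)" by (simp add: sum_distrib_left)
  also have "\<dots> \<le> m * (\<rho> * p i)" using sub m by (rule mult_left_mono)
  also have "\<dots> = \<rho> * (\<sigma> * z $ i)" using zi by simp
  finally show ?thesis by (simp add: z_def)
qed

lemma eventually_less_of_Limsup_SUP_le: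
  fixes F :: "real \<Rightarrow> 'a \<Rightarrow> real"
  assumes "Limsup at_top (\<lambda>t. SUP v\<in>S t. ereal (F t v)) \<le> ereal a" "d > 0"
  shows "eventually (\<lambda>t. \<forall>v\<in>S t. F t v \<le> a + d) at_top"
proof -
  have "Limsup at_top (\<lambda>t. SUP v\<in>S t. ereal (F t v)) < ereal (a + d)"
    by (rule order.strict_trans1[OF assms(1)]) (use assms(2) in simp)
  from Limsup_lessD[OF this] show ?thesis
  proof eventually_elim
    case (elim t)
    show ?case
    proof
      fix v assume "v \<in> S t"
      then have "ereal (F t v) \<le> (SUP v\<in>S t. ereal (F t v))" by (rule SUP_upper)
      then have "ereal (F t v) < ereal (a + d)" using elim by (rule order.strict_trans1)
      then show "F t v \<le> a + d" by simp
    qed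
  qed
qed

lemma xi_exponential_divergence:
  fixes f :: "real \<Rightarrow> real^'n \<Rightarrow> real^'n" and A :: "real^'n^'n"
  assumes f: "regular_rhs t0 f" "forward_complete f t0" and K: "compact K" and A: "metzler A"
    and diag: "\<And>i. Limsup at_top (\<lambda>t. SUP v\<in>convex hull (xi f t t0 ` K). ereal (partial_deriv (f t) i i v))
        \<le> ereal (A $ i $ i)"
    and off: "\<And>i j. i \<noteq> j \<Longrightarrow>
        Limsup at_top (\<lambda>t. SUP v\<in>convex hull (xi f t t0 ` K). ereal \<bar>partial_deriv (f t) i j v\<bar>)
        \<le> ereal (A $ i $ j)"
    and \<rho>: "\<rho> > lambda_max A" "\<rho> \<ge> 0"
  obtains C where "C > 0" "\<And>x y t. x \<in> K \<Longrightarrow> y \<in> K \<Longrightarrow> t \<ge> t0 \<Longrightarrow>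
    norm (xi f t t0 x - xi f t t0 y) \<le> C * exp (\<rho> * (t - t0)) * norm (x - y)"
proof -
  have lip: "local_lipschitz {t0..} UNIV f" using f(1) by (simp add: regular_rhs_def)
  note sol = xi_solution[OF lip f(2)]
  \<comment> \<open>The slack \<open>d\<close> left by the subeigenvector absorbs the gap between
    the upper limits of the Jacobian entries and their values from some time \<open>t1\<close>
    on.\<close>
  obtain d p where d: "d > 0" and p: "\<And>i. p i > 0"
    and sub: "\<And>i. (\<Sum>j\<in>UNIV. (A $ i $ j + d) * p j) \<le> \<rho> * p i"
    by (rule metzler_subeigenvector[OF A \<rho>(1)]) blast
  have "eventually (\<lambda>t. \<forall>i j. \<forall>v\<in>convex hull (xi f t t0 ` K).
      (if i = j then partial_deriv (f t) i j v else \<bar>partial_deriv (f t) i j v\<bar>) \<le> A $ i $ j + d) at_top"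
  proof (intro eventually_all_finite)
    fix i j
    show "eventually (\<lambda>t. \<forall>v\<in>convex hull (xi f t t0 ` K).
        (if i = j then partial_deriv (f t) i j v else \<bar>partial_deriv (f t) i j v\<bar>) \<le> A $ i $ j + d) at_top"
      using eventually_less_of_Limsup_SUP_le[OF diag d, of i] eventually_less_of_Limsup_SUP_le[OF off d, of i j]
      by (cases "i = j") simp_all
  qed
  then have "eventually (\<lambda>t. t \<ge> t0 \<and> (\<forall>i j. \<forall>v\<in>convex hull (xi f t t0 ` K).
      (if i = j then partial_deriv (f t) i j v else \<bar>partial_deriv (f t) i j v\<bar>) \<le> A $ i $ j + d)) at_top"
    by (rule eventually_conj[OF eventually_ge_at_top])
  then obtain t1 where t1_all: "\<And>t. t \<ge> t1 \<Longrightarrow> t \<ge> t0 \<and> (\<forall>i j. \<forall>v\<in>convex hull (xi f t t0 ` K).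
      (if i = j then partial_deriv (f t) i j v else \<bar>partial_deriv (f t) i j v\<bar>) \<le> A $ i $ j + d)"
    unfolding eventually_at_top_linorder by blast
  then have t1: "t1 \<ge> t0" and bound: "\<And>t i j v. t \<ge> t1 \<Longrightarrow> v \<in> convex hull (xi f t t0 ` K) \<Longrightarrow>
      (if i = j then partial_deriv (f t) i j v else \<bar>partial_deriv (f t) i j v\<bar>) \<le> A $ i $ j + d"
    by blast+
  obtain M where M: "M > 0" "\<And>x y t. x \<in> K \<Longrightarrow> y \<in> K \<Longrightarrow> t \<in> {t0..t1} \<Longrightarrow>
      norm (xi f t t0 x - xi f t t0 y) \<le> M * norm (x - y)"
    by (rule xi_lipschitz_on_compact[OF lip f(2) t1 K]) blast
  \<comment> \<open>Dividing by the smallest weight turns the uniform bound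
    \<open>M * norm (x - y)\<close> at time \<open>t1\<close> into one proportional to each
    \<open>p i\<close>; \<open>C\<close> then sums the components.\<close>
  define q where "q = Min (range p)"
  have q: "q > 0" "\<And>i. q \<le> p i" using p by (auto simp: q_def)
  define C where "C = (\<Sum>i\<in>UNIV. M * p i / q)"
  have "C > 0" unfolding C_def using M(1) p q by (intro sum_pos) auto
  show ?thesis
  \<comment> \<open>The summand \<open>M\<close> serves times up to \<open>t1\<close> and
    \<open>C\<close> the later ones. Both cases use \<open>\<rho> \<ge> 0\<close>: the exponential
    is at least 1, and counting time from \<open>t0\<close> instead of \<open>t1\<close> only
    enlarges it.\<close>
  proof (rule that[of "M + C"])
    fix x y t assume xy: "x \<in> K" "y \<in> K" and t: "t \<ge> t0"
    define w where "w s = xi f s t0 x - xi f s t0 y" for s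
    show "norm (xi f t t0 x - xi f t t0 y) \<le> (M + C) * exp (\<rho> * (t - t0)) * norm (x - y)"
    proof (cases "t \<le> t1")
      case True
      have "norm (xi f t t0 x - xi f t t0 y) \<le> M * norm (x - y)" using True t xy by (intro M) auto
      also have "\<dots> = M * 1 * norm (x - y)" by simp
      also have "\<dots> \<le> (M + C) * exp (\<rho> * (t - t0)) * norm (x - y)"
        using M(1) \<open>C > 0\<close> \<rho>(2) t by (intro mult_right_mono mult_mono) auto
      finally show ?thesis .
    next
      case False
      define w' where "w' s = f s (xi f s t0 x) - f s (xi f s t0 y)" for s
      obtain D where D: "countable D" "continuous_on {t1..t} w"
        "\<And>s. s \<in> {t1..<t} - D \<Longrightarrow> (w has_vector_derivative w' s) (at_right s)"
        unfolding w_def w'_def by (rule solution_difference[OF sol sol t1]) blast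
      have comp: "\<bar>w t $ i\<bar> \<le> M * norm (x - y) / q * p i * exp (\<rho> * (t - t1))" for i
      proof (rule weighted_max_norm_growth[OF _ D(2,1,3)])
        fix i
        have "\<bar>w t1 $ i\<bar> \<le> norm (w t1)" by (rule component_le_norm_cart)
        also have "\<dots> \<le> M * norm (x - y)" unfolding w_def using xy t1 by (intro M) auto
        also have "\<dots> \<le> M * norm (x - y) * (p i / q)"
          using mult_left_mono[of 1 "p i / q" "M * norm (x - y)"] q M(1) by simp
        finally show "\<bar>w t1 $ i\<bar> \<le> M * norm (x - y) / q * p i" by simp
      next
        fix s i and \<sigma> :: real assume s: "s \<in> {t1..<t} - D" and \<sigma>: "\<bar>\<sigma>\<bar> = 1"
          and max: "\<And>j. \<bar>w s $ j\<bar> * p i \<le> \<sigma> * w s $ i * p j"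
        have seg: "closed_segment (xi f s t0 y) (xi f s t0 x) \<subseteq> convex hull (xi f s t0 ` K)"
          using xy by (intro closed_segment_subset convex_convex_hull) (auto intro: hull_inc)
        show "\<sigma> * w' s $ i \<le> \<rho> * (\<sigma> * w s $ i)"
          unfolding w_def w'_def
        proof (rule signed_component_difference_le[OF _ _ _ p sub \<sigma>])
          show "f s differentiable (at v)" for v
            using f(1) s t1 by (auto simp: regular_rhs_def C1_map_def)
          show "partial_deriv (f s) i i v \<le> A $ i $ i + d"
            if "v \<in> closed_segment (xi f s t0 y) (xi f s t0 x)" for v i
            using bound[of s v i i] s that seg by auto
          show "\<bar>partial_deriv (f s) i j v\<bar> \<le> A $ i $ j + d"
            if "v \<in> closed_segment (xi f s t0 y) (xi f s t0 x)" "i \<noteq> j" for v i j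
            using bound[of s v i j] s that seg by auto
        qed (use max in \<open>simp add: w_def\<close>)
      qed (use False p in auto)
      have "norm (w t) \<le> (\<Sum>i\<in>UNIV. \<bar>w t $ i\<bar>)" by (rule norm_le_l1_cart)
      also have "\<dots> \<le> (\<Sum>i\<in>UNIV. M * norm (x - y) / q * p i * exp (\<rho> * (t - t1)))"
        by (rule sum_mono) (rule comp)
      also have "\<dots> = C * norm (x - y) * exp (\<rho> * (t - t1))"
        unfolding C_def sum_distrib_right by (rule sum.cong) (simp_all add: mult_ac)
      also have "\<dots> \<le> C * norm (x - y) * exp (\<rho> * (t - t0))"
        using \<open>C > 0\<close> \<rho>(2) t1 by (intro mult_left_mono) (auto intro!: mult_left_mono)
      also have "\<dots> \<le> (M + C) * norm (x - y) * exp (\<rho> * (t - t0))"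
        using M(1) by (intro mult_right_mono) auto
      finally show ?thesis by (simp add: w_def mult_ac)
    qed
  qed (use M(1) \<open>C > 0\<close> in auto)
qed

section \<open>Spanning sets and entropy\<close>

text \<open>One representative is chosen in each grid cell that meets \<open>K\<close>, which keeps
  the net inside \<open>K\<close> as spanning sets require. With mesh \<open>\<delta> / n\<close> in
  dimension \<open>n\<close>, two points of a cell are within \<open>\<delta>\<close> in the l1
  norm, hence in the Euclidean norm.\<close>

lemma finite_net_card_le:
  fixes K :: "(real^'n) set"
  assumes "bounded K"
  obtains Q where "Q > 0"
    "\<And>\<delta>. \<delta> > 0 \<Longrightarrow> \<exists>E\<subseteq>K. finite E \<and> real (card E) \<le> (Q * (1 + 1 / \<delta>)) ^ CARD('n) \<and>
      (\<forall>x\<in>K. \<exists>y\<in>E. norm (x - y) \<le> \<delta>)"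
proof -
  let ?n = "real CARD('n)"
  obtain R where R: "R > 0" "\<And>x. x \<in> K \<Longrightarrow> norm x \<le> R" using assms unfolding bounded_pos by blast
  \<comment> \<open>Each axis has \<open>2 * m + 1\<close> cell indices with
    \<open>m \<le> R / h + 1\<close>: this gives the constant 3, while
    \<open>R / h = R * ?n / \<delta>\<close> gives the other summand.\<close>
  define Q where "Q = 2 * R * ?n + 3"
  have "\<exists>E\<subseteq>K. finite E \<and> real (card E) \<le> (Q * (1 + 1 / \<delta>)) ^ CARD('n) \<and>
      (\<forall>x\<in>K. \<exists>y\<in>E. norm (x - y) \<le> \<delta>)" if \<delta>: "\<delta> > 0" for \<delta>
  proof -
    define h where "h = \<delta> / ?n"
    have h: "h > 0" using \<delta> by (simp add: h_def)
    \<comment> \<open>\<open>c x\<close> is the integer index of the grid cell containing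
      \<open>x\<close>.\<close>
    define c where "c x = (\<lambda>i. \<lfloor>x $ i / h\<rfloor>)" for x :: "real^'n"
    define m where "m = \<lceil>R / h\<rceil>"
    define P where "P = (UNIV::'n set) \<rightarrow>\<^sub>E {- m..m}"
    have "c x \<in> P" if "x \<in> K" for x
    proof -
      have "\<lfloor>x $ i / h\<rfloor> \<in> {- m..m}" for i
      proof -
        have "\<bar>x $ i\<bar> \<le> R" using component_le_norm_cart[of x i] R(2)[OF that] by linarith
        then have "\<bar>x $ i / h\<bar> \<le> R / h" using h by (simp add: divide_right_mono)
        also have "\<dots> \<le> m" by (simp add: m_def)
        finally have "x $ i / h \<le> m" "- m \<le> x $ i / h" by linarith+
        then show ?thesis by (simp add: le_floor_iff) linarith
      qed
      then show ?thesis by (auto simp: P_def c_def)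
    qed
    then have cK: "c ` K \<subseteq> P" by blast
    have fin: "finite P" by (auto simp: P_def intro: finite_PiE)
    have "R / h > 0" using R(1) h by simp
    then have "m \<ge> 0" by (simp add: m_def)
    have "card P = nat (2 * m + 1) ^ CARD('n)" by (simp add: P_def card_funcsetE)
    then have "real (card P) = (2 * real_of_int m + 1) ^ CARD('n)" using \<open>m \<ge> 0\<close> by simp
    also have "\<dots> \<le> (Q * (1 + 1 / \<delta>)) ^ CARD('n)"
    proof (rule power_mono)
      have "real_of_int m \<le> R / h + 1" by (simp add: m_def)
      also have "R / h = R * ?n * (1 / \<delta>)" by (simp add: h_def)
      finally have "2 * real_of_int m + 1 \<le> 2 * R * ?n * (1 / \<delta>) + 3" by simp
      also have "\<dots> \<le> 2 * R * ?n * (1 + 1 / \<delta>) + 3 * (1 + 1 / \<delta>)"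
        using R(1) \<delta> by (intro add_mono mult_left_mono) auto
      finally show "2 * real_of_int m + 1 \<le> Q * (1 + 1 / \<delta>)" by (simp add: Q_def algebra_simps)
    qed (use \<open>m \<ge> 0\<close> in simp)
    finally have cardP: "real (card P) \<le> (Q * (1 + 1 / \<delta>)) ^ CARD('n)" .
    define E where "E = inv_into K c ` (c ` K)"
    have finK: "finite (c ` K)" using fin cK by (rule rev_finite_subset)
    have "card E \<le> card P"
      unfolding E_def by (rule order.trans[OF card_image_le[OF finK] card_mono[OF fin cK]])
    moreover have "\<exists>y\<in>E. norm (x - y) \<le> \<delta>" if x: "x \<in> K" for x
    proof
      define y where "y = inv_into K c (c x)"
      show "y \<in> E" using x by (auto simp: E_def y_def)
      have "c y = c x" unfolding y_def using x by (intro f_inv_into_f) auto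
      have "\<bar>(x - y) $ i\<bar> \<le> h" for i
      proof -
        have "\<lfloor>x $ i / h\<rfloor> = \<lfloor>y $ i / h\<rfloor>" using \<open>c y = c x\<close> by (simp add: c_def fun_eq_iff)
        then have "\<bar>x $ i / h - y $ i / h\<bar> \<le> 1" by linarith
        then have "\<bar>(x $ i - y $ i) / h\<bar> \<le> 1" by (simp add: diff_divide_distrib)
        then show ?thesis using h by (simp add: field_simps)
      qed
      then have "(\<Sum>i\<in>UNIV. \<bar>(x - y) $ i\<bar>) \<le> (\<Sum>i\<in>(UNIV::'n set). h)" by (rule sum_mono)
      also have "\<dots> = \<delta>" by (simp add: h_def)
      finally show "norm (x - y) \<le> \<delta>" using norm_le_l1_cart[of "x - y"] by linarith
    qed
    moreover have "E \<subseteq> K" unfolding E_def by (auto intro: inv_into_into)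
    moreover have "finite E" using finK by (simp add: E_def)
    ultimately show ?thesis using cardP by (intro exI[of _ E]) (auto intro: order.trans of_nat_mono)
  qed
  moreover have "Q > 0" using R(1) by (auto simp: Q_def intro: add_nonneg_pos)
  ultimately show ?thesis using that by blast
qed

text \<open>Nonnegativity is not part of \<open>is_norm\<close>; it follows from the triangle
  inequality for \<open>x\<close> and its negative.\<close>

lemma is_norm_nonneg:
  assumes "is_norm N"
  shows "N x \<ge> 0"
proof -
  have N: "\<And>x. N x = 0 \<longleftrightarrow> x = 0" "\<And>c x. N (c *\<^sub>R x) = \<bar>c\<bar> * N x" "\<And>x y. N (x + y) \<le> N x + N y"
    using assms unfolding is_norm_def by blast+
  have "N (x + (-1) *\<^sub>R x) \<le> N x + N x" using N(3)[of x "(-1) *\<^sub>R x"] unfolding N(2) by simp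
  then show ?thesis using N(1)[of 0] by simp
qed

lemma is_norm_le_norm:
  fixes N :: "real^'n \<Rightarrow> real"
  assumes "is_norm N"
  obtains B where "B > 0" "\<And>x. N x \<le> B * norm x"
proof -
  have N: "\<And>x. N x = 0 \<longleftrightarrow> x = 0" "\<And>c x. N (c *\<^sub>R x) = \<bar>c\<bar> * N x" "\<And>x y. N (x + y) \<le> N x + N y"
    using assms unfolding is_norm_def by blast+
  have sum: "N (sum g S) \<le> (\<Sum>i\<in>S. N (g i))" if "finite S" for g :: "'n \<Rightarrow> real^'n" and S
    using that
  proof induction
    case empty
    show ?case using N(1)[of 0] by simp
  next
    case (insert i S)
    then show ?case using N(3)[of "g i" "sum g S"] by simp
  qed
  define B where "B = (\<Sum>i\<in>UNIV. N (axis i 1)) + 1"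
  have nn: "(\<Sum>i\<in>UNIV. N (axis i 1)) \<ge> 0" by (intro sum_nonneg is_norm_nonneg[OF assms])
  show ?thesis
  proof (rule that[of B])
    fix x
    have "N x = N (\<Sum>i\<in>UNIV. x $ i *s axis i 1)" by (simp only: basis_expansion)
    also have "\<dots> \<le> (\<Sum>i\<in>UNIV. N (x $ i *s axis i 1))" by (rule sum) simp
    also have "\<dots> = (\<Sum>i\<in>UNIV. \<bar>x $ i\<bar> * N (axis i 1))" by (simp add: scalar_mult_eq_scaleR N(2))
    also have "\<dots> \<le> (\<Sum>i\<in>UNIV. norm x * N (axis i 1))"
      by (intro sum_mono mult_right_mono component_le_norm_cart is_norm_nonneg[OF assms])
    also have "\<dots> \<le> B * norm x" by (simp add: B_def sum_distrib_left algebra_simps)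
    finally show "N x \<le> B * norm x" .
  qed (use nn in \<open>simp add: B_def\<close>)
qed

lemma ln_enat_mono:
  assumes "a \<le> b"
  shows "ln_enat a \<le> ln_enat b"
proof (cases b)
  case (enat m)
  with assms obtain k where "a = enat k" by (cases a) auto
  with enat assms show ?thesis by auto
qed simp

lemma ln_enat_le:
  assumes "real m \<le> r" "r > 0"
  shows "ln_enat (enat m) \<le> ereal (ln r)"
  using assms by simp

lemma min_spanning_antimono:
  assumes "\<epsilon> \<le> \<epsilon>'"
  shows "min_spanning N f t0 \<epsilon>' T K \<le> min_spanning N f t0 \<epsilon> T K"
proof -
  have "dyn_ball N f t0 x \<epsilon> T \<subseteq> dyn_ball N f t0 x \<epsilon>' T" for x
    using assms by (auto simp: dyn_ball_def)
  then have "is_spanning N f t0 \<epsilon> T K E \<Longrightarrow> is_spanning N f t0 \<epsilon>' T K E" for E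
    unfolding is_spanning_def by blast
  then show ?thesis unfolding min_spanning_def by (intro INF_superset_mono) auto
qed

lemma tendsto_SUP_at_right_antimono:
  fixes F :: "real \<Rightarrow> 'a::{complete_linorder, linorder_topology}"
  assumes anti: "\<And>x y. a < x \<Longrightarrow> x \<le> y \<Longrightarrow> F y \<le> F x"
  shows "(F \<longlongrightarrow> (SUP x\<in>{a<..}. F x)) (at_right a)"
proof (rule order_tendstoI)
  fix l assume "l < (SUP x\<in>{a<..}. F x)"
  then obtain y where y: "y > a" "l < F y" by (auto simp: less_SUP_iff)
  have "l < F x" if "a < x" "x < y" for x
    using anti[of x y] that y(2) by (auto intro: order.strict_trans2)
  with y(1) show "eventually (\<lambda>x. l < F x) (at_right a)" unfolding eventually_at_right_field by blast
next
  fix u assume u: "(SUP x\<in>{a<..}. F x) < u"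
  have "F x < u" if "a < x" for x using that by (intro order.strict_trans1[OF SUP_upper u]) auto
  then show "eventually (\<lambda>x. F x < u) (at_right a)"
    unfolding eventually_at_right_field by (intro exI[of _ "a + 1"]) auto
qed

text \<open>Spanning numbers grow as the radius shrinks, so the limit at 0 exists as a supremum over
  all positive radii. Thus \<open>Lim\<close> denotes, and a bound for each radius suffices.\<close>

lemma top_entropy_le:
  assumes "\<And>\<epsilon>. \<epsilon> > 0 \<Longrightarrow>
    Limsup at_top (\<lambda>T. ereal (1 / T) * ln_enat (min_spanning N f t0 \<epsilon> T K)) \<le> b"
  shows "top_entropy N f t0 K \<le> b"
proof -
  define F where "F \<epsilon> = Limsup at_top (\<lambda>T. ereal (1 / T) * ln_enat (min_spanning N f t0 \<epsilon> T K))" for \<epsilon>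
  have "F \<epsilon>' \<le> F \<epsilon>" if "\<epsilon> \<le> \<epsilon>'" for \<epsilon> \<epsilon>'
    unfolding F_def
  proof (rule Limsup_mono)
    show "eventually (\<lambda>T. ereal (1 / T) * ln_enat (min_spanning N f t0 \<epsilon>' T K)
        \<le> ereal (1 / T) * ln_enat (min_spanning N f t0 \<epsilon> T K)) at_top"
      using eventually_gt_at_top[of 0]
      by eventually_elim (intro ereal_mult_left_mono ln_enat_mono min_spanning_antimono that, simp)
  qed
  then have "(F \<longlongrightarrow> (SUP \<epsilon>\<in>{0<..}. F \<epsilon>)) (at_right 0)"
    by (intro tendsto_SUP_at_right_antimono)
  then have "top_entropy N f t0 K = (SUP \<epsilon>\<in>{0<..}. F \<epsilon>)"
    unfolding top_entropy_def F_def by (intro tendsto_Lim) auto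
  also have "\<dots> \<le> b" using assms by (intro SUP_least) (auto simp: F_def)
  finally show ?thesis .
qed

lemma entropy_le_of_exponential_divergence:
  fixes f :: "real \<Rightarrow> real^'n \<Rightarrow> real^'n"
  assumes N: "is_norm N" and K: "bounded K" and \<rho>: "\<rho> \<ge> 0" and C: "C > 0"
    and div: "\<And>x y t. x \<in> K \<Longrightarrow> y \<in> K \<Longrightarrow> t \<ge> t0 \<Longrightarrow>
      norm (xi f t t0 x - xi f t t0 y) \<le> C * exp (\<rho> * (t - t0)) * norm (x - y)"
  shows "top_entropy N f t0 K \<le> ereal (real CARD('n) * \<rho>)"
proof (rule top_entropy_le)
  fix \<epsilon> :: real assume \<epsilon>: "\<epsilon> > 0"
  let ?n = "real CARD('n)"
  obtain B where B: "B > 0" "\<And>x. N x \<le> B * norm x" by (rule is_norm_le_norm[OF N]) blast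
  obtain Q where Q: "Q > 0"
    "\<And>\<delta>. \<delta> > 0 \<Longrightarrow> \<exists>E\<subseteq>K. finite E \<and> real (card E) \<le> (Q * (1 + 1 / \<delta>)) ^ CARD('n) \<and>
      (\<forall>x\<in>K. \<exists>y\<in>E. norm (x - y) \<le> \<delta>)"
    by (rule finite_net_card_le[OF K]) blast
  \<comment> \<open>Chosen so that initial distance \<open>1 / (a * exp (\<rho> * T))\<close> keeps
    trajectories within \<open>\<epsilon> / 2\<close> in \<open>N\<close> up to time
    \<open>t0 + T\<close>. The half leaves room for the supremum in \<open>dyn_ball\<close>, which
    must be strictly below \<open>\<epsilon>\<close>.\<close>
  define a where "a = 2 * B * C / \<epsilon>"
  have a: "a > 0" using B(1) C \<epsilon> by (simp add: a_def)
  define q where "q = ?n * ln (Q * (1 + a))"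
  have count: "ln_enat (min_spanning N f t0 \<epsilon> T K) \<le> ereal (q + ?n * \<rho> * T)" if T: "T > 0" for T
  proof -
    define \<delta> where "\<delta> = 1 / (a * exp (\<rho> * T))"
    have \<delta>: "\<delta> > 0" using a by (simp add: \<delta>_def)
    have scale: "B * (C * exp (\<rho> * T) * \<delta>) = \<epsilon> / 2"
      using a B(1) C \<epsilon> by (simp add: \<delta>_def a_def)
    obtain E where E: "E \<subseteq> K" "finite E" "real (card E) \<le> (Q * (1 + 1 / \<delta>)) ^ CARD('n)"
      "\<And>x. x \<in> K \<Longrightarrow> \<exists>y\<in>E. norm (x - y) \<le> \<delta>"
      using Q(2)[OF \<delta>] by blast
    have "is_spanning N f t0 \<epsilon> T K E"
      unfolding is_spanning_def
    proof (intro conjI subsetI)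
      fix x assume x: "x \<in> K"
      then obtain y where y: "y \<in> E" "norm (x - y) \<le> \<delta>" using E(4) by blast
      have "(SUP t\<in>{t0..t0 + T}. N (xi f t t0 x - xi f t t0 y)) \<le> \<epsilon> / 2"
      proof (rule cSUP_least)
        fix t assume t: "t \<in> {t0..t0 + T}"
        have "norm (xi f t t0 x - xi f t t0 y) \<le> C * exp (\<rho> * (t - t0)) * norm (x - y)"
          using x y(1) E(1) t by (intro div) auto
        also have "\<dots> \<le> C * exp (\<rho> * T) * \<delta>"
          using C \<rho> t y(2) by (intro mult_mono) (auto intro!: mult_left_mono)
        finally have "B * norm (xi f t t0 x - xi f t t0 y) \<le> \<epsilon> / 2"
          unfolding scale[symmetric] using B(1) by (intro mult_left_mono) auto
        then show "N (xi f t t0 x - xi f t t0 y) \<le> \<epsilon> / 2" using B(2) by (rule order.trans[rotated])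
      qed (use T in simp)
      then have "x \<in> dyn_ball N f t0 y \<epsilon> T" using \<epsilon> by (simp add: dyn_ball_def)
      then show "x \<in> (\<Union>x\<in>E. dyn_ball N f t0 x \<epsilon> T)" using y(1) by blast
    qed (use E(1) in blast)
    then have "min_spanning N f t0 \<epsilon> T K \<le> enat (card E)"
      unfolding min_spanning_def using E(2) by (intro INF_lower) simp
    then have "ln_enat (min_spanning N f t0 \<epsilon> T K) \<le> ln_enat (enat (card E))" by (rule ln_enat_mono)
    also have "\<dots> \<le> ereal (ln ((Q * (1 + a) * exp (\<rho> * T)) ^ CARD('n)))"
    proof (rule ln_enat_le)
      have "1 + 1 / \<delta> = 1 + a * exp (\<rho> * T)" by (simp add: \<delta>_def)
      \<comment> \<open>As \<open>exp (\<rho> * T) \<ge> 1\<close>, the dependence on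
        \<open>T\<close> factors out; after the logarithm the rest is the constant \<open>q\<close>,
        which vanishes in the limit when divided by \<open>T\<close>.\<close>
      also have "\<dots> \<le> (1 + a) * exp (\<rho> * T)" using \<rho> T by (simp add: algebra_simps)
      finally have "(Q * (1 + 1 / \<delta>)) ^ CARD('n) \<le> (Q * ((1 + a) * exp (\<rho> * T))) ^ CARD('n)"
        using Q(1) \<delta> by (intro power_mono mult_left_mono) auto
      then show "real (card E) \<le> (Q * (1 + a) * exp (\<rho> * T)) ^ CARD('n)"
        using E(3) by (simp add: mult.assoc)
    qed (use Q(1) a in simp)
    also have "ln ((Q * (1 + a) * exp (\<rho> * T)) ^ CARD('n)) = ?n * (ln (Q * (1 + a)) + \<rho> * T)"
      using Q(1) a by (simp add: ln_realpow ln_mult)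
    also have "\<dots> = q + ?n * \<rho> * T" by (simp add: q_def algebra_simps)
    finally show ?thesis .
  qed
  have "Limsup at_top (\<lambda>T. ereal (1 / T) * ln_enat (min_spanning N f t0 \<epsilon> T K))
      \<le> Limsup at_top (\<lambda>T. ereal (q * (1 / T) + ?n * \<rho>))"
  proof (rule Limsup_mono)
    show "eventually (\<lambda>T. ereal (1 / T) * ln_enat (min_spanning N f t0 \<epsilon> T K)
        \<le> ereal (q * (1 / T) + ?n * \<rho>)) at_top"
      using eventually_gt_at_top[of 0]
    proof eventually_elim
      case (elim T)
      have "ereal (1 / T) * ln_enat (min_spanning N f t0 \<epsilon> T K) \<le> ereal (1 / T) * ereal (q + ?n * \<rho> * T)"
        using elim by (intro ereal_mult_left_mono count) auto
      also have "\<dots> = ereal (q * (1 / T) + ?n * \<rho>)" using elim by (simp add: field_simps)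
      finally show ?case .
    qed
  qed
  also have "((\<lambda>T::real. q * (1 / T) + ?n * \<rho>) \<longlongrightarrow> q * 0 + ?n * \<rho>) at_top"
    by (intro tendsto_intros tendsto_divide_0[OF tendsto_const] filterlim_at_top_imp_at_infinity filterlim_ident)
  then have "Limsup at_top (\<lambda>T. ereal (q * (1 / T) + ?n * \<rho>)) = ereal (?n * \<rho>)"
    by (intro lim_imp_Limsup) (auto simp: tendsto_ereal)
  finally show "Limsup at_top (\<lambda>T. ereal (1 / T) * ln_enat (min_spanning N f t0 \<epsilon> T K)) \<le> ereal (?n * \<rho>)" .
qed

theorem proposition1:
  fixes f :: "real \<Rightarrow> real^'n \<Rightarrow> real^'n"
    and t0 :: real
    and K :: "(real^'n) set"
    and A :: "real^'n^'n"
    and N :: "real^'n \<Rightarrow> real"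
  assumes "is_norm N"
    and "regular_rhs t0 f"
    and "forward_complete f t0"
    and "compact K" and "interior K \<noteq> {}"
    and "metzler A"
    and "\<And>i. Limsup at_top (\<lambda>t. SUP v\<in>convex hull (xi f t t0 ` K). ereal (partial_deriv (f t) i i v))
              \<le> ereal (A $ i $ i)"
    and "\<And>i j. i \<noteq> j \<Longrightarrow>
           Limsup at_top (\<lambda>t. SUP v\<in>convex hull (xi f t t0 ` K). ereal \<bar>partial_deriv (f t) i j v\<bar>)
              \<le> ereal (A $ i $ j)"
  shows "top_entropy N f t0 K \<le> ereal (real CARD('n) * max (lambda_max A) 0)"
proof (rule ereal_le_epsilon2)
  fix e :: real assume e: "e > 0"
  \<comment> \<open>The excess \<open>e / n\<close> makes \<open>\<rho>\<close> strictly larger than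
    \<open>lambda_max A\<close> and costs exactly \<open>e\<close> after multiplication by the
    dimension.\<close>
  define \<rho> where "\<rho> = max (lambda_max A) 0 + e / real CARD('n)"
  have "e / real CARD('n) > 0" using e by simp
  then have \<rho>: "\<rho> > lambda_max A" "\<rho> \<ge> 0" by (simp_all add: \<rho>_def)
  obtain C where C: "C > 0" "\<And>x y t. x \<in> K \<Longrightarrow> y \<in> K \<Longrightarrow> t \<ge> t0 \<Longrightarrow>
      norm (xi f t t0 x - xi f t t0 y) \<le> C * exp (\<rho> * (t - t0)) * norm (x - y)"
    by (rule xi_exponential_divergence[OF assms(2,3,4,6-8) \<rho>]) blast+
  have "top_entropy N f t0 K \<le> ereal (real CARD('n) * \<rho>)"
    by (rule entropy_le_of_exponential_divergence[OF assms(1) compact_imp_bounded[OF assms(4)] \<rho>(2) C])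
  also have "real CARD('n) * \<rho> = real CARD('n) * max (lambda_max A) 0 + e"
    by (simp add: \<rho>_def distrib_left)
  finally show "top_entropy N f t0 K \<le> ereal (real CARD('n) * max (lambda_max A) 0) + ereal e" by simp
qed

end
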